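(* Let $\Omega\subset\mathbb{R}^n$ be a bounded domain with smooth boundary, let $\rho,a,b,c,d>0$ and $\eta\in\mathbb{R}\setminus\{0\}$. Let $(u,\theta)$ be a solution on $\Omega\times[0,\infty)$ of the backward-in-time system $$\rho u_{tt}=-c\Delta^2u+\eta\Delta\theta,\qquad a\theta_t=d\Delta^2\theta-b\Delta\theta-\eta\Delta u_t,$$ with boundary conditions $u=\Delta u=\theta=\Delta\theta=0$ on $\partial\Omega$ for $t>0$, and null initial conditions $u(x,0)=u_t(x,0)=\theta(x,0)=0$ for all $x\in\Omega$. Then $(u,\theta)=(0,0)$ for every $t\ge0$.
   Context: Functions are real-valued. $H_*^4(\Omega)=\{w\in H^4(\Omega): w=\Delta w=0\text{ on }\partial\Omega\}$. Solutions are understood in the strong sense: $u\in C^2([0,\infty);L^2(\Omega))\cap C^1([0,\infty);H^2(\Omega)\cap H_0^1(\Omega))\cap C([0,\infty);H_*^4(\Omega))$ and $\theta\in C^1([0,\infty);L^2(\Omega))\cap C([0,\infty);H_*^4(\Omega))$, with the equations holding in $L^2(\Omega)$ for all $t$. *)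

theory Defs
  imports "HOL-Analysis.Analysis"
begin

(* Throughout, Omega is a subset of a Euclidean space of arbitrary dimension n >= 1.  Elements
   of L^2(Omega) and of the Sobolev spaces are represented by functions on the whole space; only
   their values almost everywhere on Omega matter. *)

fun C_k_on :: "nat \<Rightarrow> 'a::euclidean_space set \<Rightarrow> ('a \<Rightarrow> real) \<Rightarrow> bool" where
  "C_k_on 0 S f = continuous_on S f"
| "C_k_on (Suc k) S f =
     ((\<forall>x\<in>S. f differentiable (at x)) \<and>
      (\<forall>v. C_k_on k S (\<lambda>x. frechet_derivative f (at x) v)))"

(* Meant for open S. *)
definition smooth_on :: "'a::euclidean_space set \<Rightarrow> ('a \<Rightarrow> real) \<Rightarrow> bool" where
  "smooth_on S f \<longleftrightarrow> (\<forall>k. C_k_on k S f)"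

(* Near each boundary point Omega is, up to a rigid motion, the region above the graph of a smooth
   function of the n-1 coordinates orthogonal to the unit vector e. *)
definition smooth_boundary :: "'a::euclidean_space set \<Rightarrow> bool" where
  "smooth_boundary \<Omega> \<longleftrightarrow>
     (\<forall>p\<in>frontier \<Omega>. \<exists>r>0. \<exists>e. \<exists>\<gamma>. norm e = 1 \<and> smooth_on UNIV \<gamma> \<and>
        \<Omega> \<inter> ball p r = {x \<in> ball p r. x \<bullet> e > \<gamma> (x - (x \<bullet> e) *\<^sub>R e)})"

definition bounded_smooth_domain :: "'a::euclidean_space set \<Rightarrow> bool" where
  "bounded_smooth_domain \<Omega> \<longleftrightarrow>
     open \<Omega> \<and> connected \<Omega> \<and> \<Omega> \<noteq> {} \<and> bounded \<Omega> \<and> smooth_boundary \<Omega>"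

definition L2 :: "'a::euclidean_space set \<Rightarrow> ('a \<Rightarrow> real) set" where
  "L2 \<Omega> = {f. f \<in> borel_measurable (lebesgue_on \<Omega>) \<and>
               integrable (lebesgue_on \<Omega>) (\<lambda>x. (f x)\<^sup>2)}"

definition L2_nrm :: "'a::euclidean_space set \<Rightarrow> ('a \<Rightarrow> real) \<Rightarrow> real" where
  "L2_nrm \<Omega> f = sqrt (LINT x|lebesgue_on \<Omega>. (f x)\<^sup>2)"

definition test_fun :: "'a::euclidean_space set \<Rightarrow> ('a \<Rightarrow> real) set" where
  "test_fun \<Omega> = {\<phi>. smooth_on UNIV \<phi> \<and> compact (closure {x. \<phi> x \<noteq> 0}) \<and>
                    closure {x. \<phi> x \<noteq> 0} \<subseteq> \<Omega>}"

(* Iterated partial derivatives are indexed by lists of basis vectors: [v1, ..., vk] stands for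
   the mixed derivative in the directions v1, ..., vk.  The lists of length k enumerate the
   components of the tensor of all k-th order derivatives. *)
definition partials :: "'a::euclidean_space list \<Rightarrow> ('a \<Rightarrow> real) \<Rightarrow> 'a \<Rightarrow> real" where
  "partials vs \<phi> = foldr (\<lambda>v f x. frechet_derivative f (at x) v) vs \<phi>"

definition has_weak_partials ::
  "'a::euclidean_space set \<Rightarrow> 'a list \<Rightarrow> ('a \<Rightarrow> real) \<Rightarrow> ('a \<Rightarrow> real) \<Rightarrow> bool" where
  "has_weak_partials \<Omega> vs f g \<longleftrightarrow>
     (\<forall>\<phi>\<in>test_fun \<Omega>. (LINT x|lebesgue_on \<Omega>. f x * partials vs \<phi> x) =
        (-1) ^ length vs * (LINT x|lebesgue_on \<Omega>. g x * \<phi> x))"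

(* Unique up to null sets when it exists in L^2; used only in that case. *)
definition weak_partials ::
  "'a::euclidean_space set \<Rightarrow> 'a list \<Rightarrow> ('a \<Rightarrow> real) \<Rightarrow> 'a \<Rightarrow> real" where
  "weak_partials \<Omega> vs f = (SOME g. g \<in> L2 \<Omega> \<and> has_weak_partials \<Omega> vs f g)"

definition indices :: "nat \<Rightarrow> 'a::euclidean_space list set" where
  "indices k = {vs. set vs \<subseteq> Basis \<and> length vs \<le> k}"

definition H :: "nat \<Rightarrow> 'a::euclidean_space set \<Rightarrow> ('a \<Rightarrow> real) set" where
  "H k \<Omega> = {f \<in> L2 \<Omega>. \<forall>vs\<in>indices k. \<exists>g\<in>L2 \<Omega>. has_weak_partials \<Omega> vs f g}"

definition H_nrm :: "nat \<Rightarrow> 'a::euclidean_space set \<Rightarrow> ('a \<Rightarrow> real) \<Rightarrow> real" where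
  "H_nrm k \<Omega> f = sqrt (\<Sum>vs\<in>indices k. (L2_nrm \<Omega> (weak_partials \<Omega> vs f))\<^sup>2)"

(* The closure of the test functions in H^1. *)
definition H10 :: "'a::euclidean_space set \<Rightarrow> ('a \<Rightarrow> real) set" where
  "H10 \<Omega> = {f \<in> H 1 \<Omega>. \<exists>\<phi>. (\<forall>k::nat. \<phi> k \<in> test_fun \<Omega>) \<and>
              (\<lambda>k. H_nrm 1 \<Omega> (\<lambda>x. f x - \<phi> k x)) \<longlonglongrightarrow> 0}"

definition lap :: "'a::euclidean_space set \<Rightarrow> ('a \<Rightarrow> real) \<Rightarrow> 'a \<Rightarrow> real" where
  "lap \<Omega> f = (\<lambda>x. \<Sum>v\<in>Basis. weak_partials \<Omega> [v, v] f x)"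

(* "w = 0 on the boundary" for w in H^1, i.e. vanishing trace, means membership in H^1_0. *)
definition zero_on_boundary :: "'a::euclidean_space set \<Rightarrow> ('a \<Rightarrow> real) \<Rightarrow> bool" where
  "zero_on_boundary \<Omega> w \<longleftrightarrow> w \<in> H10 \<Omega>"

definition H4_star :: "'a::euclidean_space set \<Rightarrow> ('a \<Rightarrow> real) set" where
  "H4_star \<Omega> = {w \<in> H 4 \<Omega>. zero_on_boundary \<Omega> w \<and> zero_on_boundary \<Omega> (lap \<Omega> w)}"

(* f belongs to C([0,oo); X), where X carries the norm N. *)
definition C0_time ::
  "('a \<Rightarrow> real) set \<Rightarrow> (('a \<Rightarrow> real) \<Rightarrow> real) \<Rightarrow> (real \<Rightarrow> 'a \<Rightarrow> real) \<Rightarrow> bool" where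
  "C0_time X N f \<longleftrightarrow>
     (\<forall>t\<ge>0. f t \<in> X \<and> ((\<lambda>s. N (\<lambda>x. f s x - f t x)) \<longlongrightarrow> 0) (at t within {0..}))"

(* f belongs to C^1([0,oo); X) with derivative f' (one-sided at t = 0). *)
definition C1_time ::
  "('a \<Rightarrow> real) set \<Rightarrow> (('a \<Rightarrow> real) \<Rightarrow> real) \<Rightarrow> (real \<Rightarrow> 'a \<Rightarrow> real) \<Rightarrow>
   (real \<Rightarrow> 'a \<Rightarrow> real) \<Rightarrow> bool" where
  "C1_time X N f f' \<longleftrightarrow> C0_time X N f \<and> C0_time X N f' \<and>
     (\<forall>t\<ge>0. ((\<lambda>s. N (\<lambda>x. (f s x - f t x) / (s - t) - f' t x)) \<longlongrightarrow> 0) (at t within {0..}))"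

(* Regularity of strong solutions; ut, utt and \<theta>t are the time derivatives of u and \<theta>. *)
definition strong_regularity ::
  "'a::euclidean_space set \<Rightarrow> (real \<Rightarrow> 'a \<Rightarrow> real) \<Rightarrow> (real \<Rightarrow> 'a \<Rightarrow> real) \<Rightarrow>
   (real \<Rightarrow> 'a \<Rightarrow> real) \<Rightarrow> (real \<Rightarrow> 'a \<Rightarrow> real) \<Rightarrow> (real \<Rightarrow> 'a \<Rightarrow> real) \<Rightarrow> bool" where
  "strong_regularity \<Omega> u ut utt \<theta> \<theta>t \<longleftrightarrow>
     C1_time (L2 \<Omega>) (L2_nrm \<Omega>) u ut \<and> C1_time (L2 \<Omega>) (L2_nrm \<Omega>) ut utt \<and>
     C1_time (H 2 \<Omega> \<inter> H10 \<Omega>) (H_nrm 2 \<Omega>) u ut \<and>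
     C0_time (H4_star \<Omega>) (H_nrm 4 \<Omega>) u \<and>
     C1_time (L2 \<Omega>) (L2_nrm \<Omega>) \<theta> \<theta>t \<and>
     C0_time (H4_star \<Omega>) (H_nrm 4 \<Omega>) \<theta>"

end

theory Submission
  imports Defs
begin

text \<open>Write \<open>L\<close> for the Laplacian on \<open>H\<^sup>2 \<inter> H\<^sup>1\<^sub>0\<close>, which is symmetric. For null initial data the Lagrange
  identity obtained by pairing the states at times \<open>t + s\<close> and \<open>t - s\<close> yields
  \<open>\<rho> |u\<^sub>t|\<^sup>2 = c |L u|\<^sup>2 + a |\<theta>|\<^sup>2\<close>. Let \<open>E\<^sub>1\<close> and \<open>E\<^sub>2\<close> be half of
  \<open>\<rho> |u\<^sub>t|\<^sup>2 + c |L u|\<^sup>2 + a |\<theta>|\<^sup>2\<close> and of \<open>\<rho> |u\<^sub>t|\<^sup>2 + c |L u|\<^sup>2 - a |\<theta>|\<^sup>2\<close>. The derivative of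
  \<open>E\<^sub>1\<close> contains the bad term \<open>d |L \<theta>|\<^sup>2\<close>, that of \<open>E\<^sub>2\<close> the good term \<open>- d |L \<theta>|\<^sup>2\<close>, and the Lagrange
  identity turns \<open>E\<^sub>1 / 2 + E\<^sub>2\<close> into the positive quantity \<open>\<rho> |u\<^sub>t|\<^sup>2 / 2 + c |L u|\<^sup>2\<close>, to which Gronwall's
  inequality applies.\<close>

section \<open>The space \<open>L\<^sup>2\<close>\<close>

text \<open>Backward in time the heat term has the wrong sign, so an energy with only plus signs has
  an uncontrolled derivative; flipping the sign of the \<open>\<theta>\<close> part restores
  dissipation but loses positivity. The Lagrange identity resolves this conflict because the
  symmetry behind it holds for either sign of the diffusion. For 0 < e < 1 the combination e E1 + E2
  equals e \<rho> |ut|^2 + c |L u|^2 and dissipates (1 - e) d |L \<theta>|^2; the proof takes e =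
  1/2. The remaining terms of its derivative are linear in L \<theta> (the coupling cancels in E1
  and doubles in E2), so the dissipation absorbs them, and what is left is bounded by the energy
  since the identity also gives a |\<theta>|^2 <= \<rho> |ut|^2. A different obstacle shapes the
  first half: weak derivatives are picked by \<open>SOME\<close>, so L is linear only almost
  everywhere, and only once weak derivatives are known to be unique. The bump functions and the
  fundamental lemma serve this purpose. Since \<open>H10\<close> is a closure of test functions,
  Green's formula, and with it the symmetry of L, then follows by density.\<close>

definition L2_inner :: "'a::euclidean_space set \<Rightarrow> ('a \<Rightarrow> real) \<Rightarrow> ('a \<Rightarrow> real) \<Rightarrow> real" where
  "L2_inner \<Omega> f g = (LINT x|lebesgue_on \<Omega>. f x * g x)"

lemma L2_measurable: "f \<in> L2 \<Omega> \<Longrightarrow> f \<in> borel_measurable (lebesgue_on \<Omega>)"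
  by (simp add: L2_def)

lemma L2_integrable_square: "f \<in> L2 \<Omega> \<Longrightarrow> integrable (lebesgue_on \<Omega>) (\<lambda>x. (f x)\<^sup>2)"
  by (simp add: L2_def)

lemma L2_integrable_mult:
  assumes "f \<in> L2 \<Omega>" "g \<in> L2 \<Omega>"
  shows "integrable (lebesgue_on \<Omega>) (\<lambda>x. f x * g x)"
proof (rule Bochner_Integration.integrable_bound)
  show "integrable (lebesgue_on \<Omega>) (\<lambda>x. (f x)\<^sup>2 + (g x)\<^sup>2)"
    using assms by (simp add: L2_integrable_square)
  show "(\<lambda>x. f x * g x) \<in> borel_measurable (lebesgue_on \<Omega>)"
    using assms[THEN L2_measurable] by measurable
  have "\<bar>p * q\<bar> \<le> p\<^sup>2 + q\<^sup>2" for p q :: real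
  proof -
    have "2 * \<bar>p\<bar> * \<bar>q\<bar> \<le> p\<^sup>2 + q\<^sup>2" "0 \<le> \<bar>p\<bar> * \<bar>q\<bar>"
      using sum_squares_bound[of "\<bar>p\<bar>" "\<bar>q\<bar>"] by simp_all
    then show ?thesis unfolding abs_mult by linarith
  qed
  then show "AE x in lebesgue_on \<Omega>. norm (f x * g x) \<le> norm ((f x)\<^sup>2 + (g x)\<^sup>2)"
    by simp
qed

lemma L2_zero: "(\<lambda>x. 0) \<in> L2 \<Omega>"
  by (simp add: L2_def)

lemma L2_cmult: "f \<in> L2 \<Omega> \<Longrightarrow> (\<lambda>x. r * f x) \<in> L2 \<Omega>"
  unfolding L2_def by (auto simp: power_mult_distrib)

lemma L2_add:
  assumes "f \<in> L2 \<Omega>" "g \<in> L2 \<Omega>"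
  shows "(\<lambda>x. f x + g x) \<in> L2 \<Omega>"
proof -
  have "integrable (lebesgue_on \<Omega>) (\<lambda>x. (f x)\<^sup>2 + (g x)\<^sup>2 + 2 * (f x * g x))"
    using assms L2_integrable_mult[OF assms] by (auto simp: L2_integrable_square)
  moreover have "(\<lambda>x. f x + g x) \<in> borel_measurable (lebesgue_on \<Omega>)"
    using assms[THEN L2_measurable] by measurable
  ultimately show ?thesis
    by (simp add: L2_def power2_sum mult.assoc)
qed

lemma L2_diff:
  assumes "f \<in> L2 \<Omega>" "g \<in> L2 \<Omega>"
  shows "(\<lambda>x. f x - g x) \<in> L2 \<Omega>"
  using L2_add[OF assms(1) L2_cmult[OF assms(2), of "-1"]] by simp

lemma L2_uminus: "f \<in> L2 \<Omega> \<Longrightarrow> (\<lambda>x. - f x) \<in> L2 \<Omega>"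
  using L2_cmult[of f \<Omega> "-1"] by simp

lemma L2_sum:
  assumes "\<And>i. i \<in> I \<Longrightarrow> f i \<in> L2 \<Omega>"
  shows "(\<lambda>x. \<Sum>i\<in>I. f i x) \<in> L2 \<Omega>"
  using assms by (induction I rule: infinite_finite_induct) (auto intro: L2_zero L2_add)

lemma L2_inner_commute: "L2_inner \<Omega> f g = L2_inner \<Omega> g f"
  by (simp add: L2_inner_def mult.commute)

lemma L2_inner_add_left:
  assumes "f \<in> L2 \<Omega>" "g \<in> L2 \<Omega>" "h \<in> L2 \<Omega>"
  shows "L2_inner \<Omega> (\<lambda>x. f x + g x) h = L2_inner \<Omega> f h + L2_inner \<Omega> g h"
  using assms by (simp add: L2_inner_def L2_integrable_mult distrib_right)

lemma L2_inner_diff_left: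
  assumes "f \<in> L2 \<Omega>" "g \<in> L2 \<Omega>" "h \<in> L2 \<Omega>"
  shows "L2_inner \<Omega> (\<lambda>x. f x - g x) h = L2_inner \<Omega> f h - L2_inner \<Omega> g h"
  using assms by (simp add: L2_inner_def L2_integrable_mult left_diff_distrib)

lemma L2_inner_cmult_left: "L2_inner \<Omega> (\<lambda>x. r * f x) h = r * L2_inner \<Omega> f h"
  by (simp add: L2_inner_def mult.assoc)

lemma L2_inner_sum_left:
  assumes "\<And>i. i \<in> I \<Longrightarrow> f i \<in> L2 \<Omega>" "h \<in> L2 \<Omega>"
  shows "L2_inner \<Omega> (\<lambda>x. \<Sum>i\<in>I. f i x) h = (\<Sum>i\<in>I. L2_inner \<Omega> (f i) h)"
  using assms by (simp add: L2_inner_def sum_distrib_right L2_integrable_mult Bochner_Integration.integral_sum)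

lemma L2_inner_zero: "L2_inner \<Omega> (\<lambda>x. 0) f = 0"
  by (simp add: L2_inner_def)

lemma L2_inner_diff_right:
  assumes "f \<in> L2 \<Omega>" "g \<in> L2 \<Omega>" "h \<in> L2 \<Omega>"
  shows "L2_inner \<Omega> h (\<lambda>x. f x - g x) = L2_inner \<Omega> h f - L2_inner \<Omega> h g"
  using L2_inner_diff_left[OF assms] by (simp add: L2_inner_commute)

lemma L2_inner_add_right:
  assumes "f \<in> L2 \<Omega>" "g \<in> L2 \<Omega>" "h \<in> L2 \<Omega>"
  shows "L2_inner \<Omega> h (\<lambda>x. f x + g x) = L2_inner \<Omega> h f + L2_inner \<Omega> h g"
  using L2_inner_add_left[OF assms] by (simp add: L2_inner_commute)

lemma L2_inner_cmult_right: "L2_inner \<Omega> h (\<lambda>x. r * f x) = r * L2_inner \<Omega> h f"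
  by (simp add: L2_inner_def mult.left_commute)

lemma L2_inner_cong_AE:
  assumes "f \<in> L2 \<Omega>" "f' \<in> L2 \<Omega>" "g \<in> L2 \<Omega>" "AE x in lebesgue_on \<Omega>. f x = f' x"
  shows "L2_inner \<Omega> f g = L2_inner \<Omega> f' g"
  unfolding L2_inner_def by (rule integral_cong_AE)
    (use assms in \<open>auto intro!: borel_measurable_times intro: L2_measurable\<close>)

lemma L2_inner_self: "L2_inner \<Omega> f f = (L2_nrm \<Omega> f)\<^sup>2"
  by (simp add: L2_inner_def L2_nrm_def power2_eq_square)

lemma L2_nrm_nonneg [simp]: "0 \<le> L2_nrm \<Omega> f"
  by (simp add: L2_nrm_def)

lemma L2_nrm_eq_0_iff:
  assumes "f \<in> L2 \<Omega>"
  shows "L2_nrm \<Omega> f = 0 \<longleftrightarrow> (AE x in lebesgue_on \<Omega>. f x = 0)"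
  using integral_nonneg_eq_0_iff_AE[OF L2_integrable_square[OF assms]] by (simp add: L2_nrm_def)

lemma L2_nrm_cong_AE:
  assumes "f \<in> L2 \<Omega>" "g \<in> L2 \<Omega>" "AE x in lebesgue_on \<Omega>. f x = g x"
  shows "L2_nrm \<Omega> f = L2_nrm \<Omega> g"
proof -
  have "L2_inner \<Omega> f f = L2_inner \<Omega> g g"
    unfolding L2_inner_def by (rule integral_cong_AE)
      (use assms in \<open>auto intro!: borel_measurable_times intro: L2_measurable\<close>)
  then show ?thesis by (simp add: L2_inner_self)
qed

lemma L2_Cauchy_Schwarz:
  assumes f: "f \<in> L2 \<Omega>" and g: "g \<in> L2 \<Omega>"
  shows "\<bar>L2_inner \<Omega> f g\<bar> \<le> L2_nrm \<Omega> f * L2_nrm \<Omega> g"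
proof (cases "L2_nrm \<Omega> g = 0")
  case True
  then have "AE x in lebesgue_on \<Omega>. g x = 0"
    using L2_nrm_eq_0_iff[OF g] by simp
  then have "L2_inner \<Omega> g f = L2_inner \<Omega> (\<lambda>x. 0) f"
    by (intro L2_inner_cong_AE L2_zero f g)
  then show ?thesis using True by (simp add: L2_inner_commute[of \<Omega> f] L2_inner_zero)
next
  case False
  \<comment> \<open>\<open>r\<close> is the coefficient of the orthogonal projection of
    \<open>f\<close> onto \<open>g\<close>; the inequality says that the squared distance to it is
    nonnegative.\<close>
  define r where "r = L2_inner \<Omega> f g / (L2_nrm \<Omega> g)\<^sup>2"
  have rg: "(\<lambda>x. r * g x) \<in> L2 \<Omega>" using g by (rule L2_cmult)
  have "0 \<le> L2_inner \<Omega> (\<lambda>x. f x - r * g x) (\<lambda>x. f x - r * g x)"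
    by (simp add: L2_inner_self)
  also have "\<dots> = L2_inner \<Omega> f f - 2 * r * L2_inner \<Omega> f g + r\<^sup>2 * L2_inner \<Omega> g g"
    by (subst L2_inner_diff_left[OF f rg L2_diff[OF f rg]],
        subst L2_inner_diff_right[OF f rg f], subst L2_inner_diff_right[OF f rg rg],
        simp only: L2_inner_cmult_left L2_inner_cmult_right L2_inner_commute[of \<Omega> g f])
      (simp add: power2_eq_square algebra_simps)
  also have "\<dots> = (L2_nrm \<Omega> f)\<^sup>2 - (L2_inner \<Omega> f g)\<^sup>2 / (L2_nrm \<Omega> g)\<^sup>2"
    using False by (simp add: L2_inner_self r_def field_simps power2_eq_square)
  finally have "(L2_inner \<Omega> f g)\<^sup>2 \<le> (L2_nrm \<Omega> f * L2_nrm \<Omega> g)\<^sup>2"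
    using False by (simp add: field_simps power_mult_distrib)
  then show ?thesis
    by (metis L2_nrm_nonneg abs_le_square_iff abs_of_nonneg mult_nonneg_nonneg)
qed

lemma L2_nrm_triangle:
  assumes f: "f \<in> L2 \<Omega>" and g: "g \<in> L2 \<Omega>"
  shows "L2_nrm \<Omega> (\<lambda>x. f x + g x) \<le> L2_nrm \<Omega> f + L2_nrm \<Omega> g"
proof (rule power2_le_imp_le)
  have "(L2_nrm \<Omega> (\<lambda>x. f x + g x))\<^sup>2 = L2_inner \<Omega> f f + 2 * L2_inner \<Omega> f g + L2_inner \<Omega> g g"
    using f g by (simp only: L2_inner_self[symmetric] L2_inner_add_left L2_inner_add_right L2_add
      L2_inner_commute[of \<Omega> g f])
  also have "\<dots> \<le> (L2_nrm \<Omega> f + L2_nrm \<Omega> g)\<^sup>2"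
    using L2_Cauchy_Schwarz[OF f g] by (simp add: L2_inner_self power2_sum)
  finally show "(L2_nrm \<Omega> (\<lambda>x. f x + g x))\<^sup>2 \<le> (L2_nrm \<Omega> f + L2_nrm \<Omega> g)\<^sup>2" .
qed simp

lemma L2_nrm_cmult: "L2_nrm \<Omega> (\<lambda>x. r * f x) = \<bar>r\<bar> * L2_nrm \<Omega> f"
  by (simp add: L2_nrm_def power_mult_distrib real_sqrt_mult)

lemma L2_nrm_sum:
  assumes "\<And>i. i \<in> I \<Longrightarrow> f i \<in> L2 \<Omega>"
  shows "L2_nrm \<Omega> (\<lambda>x. \<Sum>i\<in>I. f i x) \<le> (\<Sum>i\<in>I. L2_nrm \<Omega> (f i))"
  using assms
proof (induction I rule: infinite_finite_induct)
  case (insert i I)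
  then have "L2_nrm \<Omega> (\<lambda>x. f i x + (\<Sum>i\<in>I. f i x)) \<le> L2_nrm \<Omega> (f i) + L2_nrm \<Omega> (\<lambda>x. \<Sum>i\<in>I. f i x)"
    by (intro L2_nrm_triangle L2_sum) auto
  then show ?case using insert by simp
qed (auto simp: L2_nrm_def)

text \<open>Membership in \<open>L2\<close> is asked only on a set \<open>S\<close> that
  \<open>F\<close> eventually enters, because paths in time are controlled only on
  \<open>{0..}\<close>. The limit follows by expanding around \<open>f0\<close> and
  \<open>g0\<close> and applying Cauchy-Schwarz to each term.\<close>

lemma tendsto_L2_inner:
  assumes "\<And>s. s \<in> S \<Longrightarrow> f s \<in> L2 \<Omega>" "\<And>s. s \<in> S \<Longrightarrow> g s \<in> L2 \<Omega>" "f0 \<in> L2 \<Omega>" "g0 \<in> L2 \<Omega>"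
    and S: "eventually (\<lambda>s. s \<in> S) F"
    and f: "((\<lambda>s. L2_nrm \<Omega> (\<lambda>x. f s x - f0 x)) \<longlongrightarrow> 0) F"
    and g: "((\<lambda>s. L2_nrm \<Omega> (\<lambda>x. g s x - g0 x)) \<longlongrightarrow> 0) F"
  shows "((\<lambda>s. L2_inner \<Omega> (f s) (g s)) \<longlongrightarrow> L2_inner \<Omega> f0 g0) F"
proof (rule LIM_zero_cancel)
  let ?N = "L2_nrm \<Omega>"
  have "((\<lambda>s. ?N (\<lambda>x. f s x - f0 x) * ?N (\<lambda>x. g s x - g0 x) + ?N (\<lambda>x. f s x - f0 x) * ?N g0
      + ?N f0 * ?N (\<lambda>x. g s x - g0 x)) \<longlongrightarrow> 0) F"
    using f g by (auto intro!: tendsto_eq_intros)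
  then show "((\<lambda>s. L2_inner \<Omega> (f s) (g s) - L2_inner \<Omega> f0 g0) \<longlongrightarrow> 0) F"
  proof (rule Lim_null_comparison[rotated])
    show "\<forall>\<^sub>F s in F. norm (L2_inner \<Omega> (f s) (g s) - L2_inner \<Omega> f0 g0)
       \<le> ?N (\<lambda>x. f s x - f0 x) * ?N (\<lambda>x. g s x - g0 x) + ?N (\<lambda>x. f s x - f0 x) * ?N g0
          + ?N f0 * ?N (\<lambda>x. g s x - g0 x)"
      using S
    proof eventually_elim
      case (elim s)
      note m = assms(1)[OF elim] assms(2)[OF elim] assms(3,4)
      note d = L2_diff[OF m(1,3)] L2_diff[OF m(2,4)]
      have "L2_inner \<Omega> (f s) (g s) - L2_inner \<Omega> f0 g0 =
         L2_inner \<Omega> (\<lambda>x. f s x - f0 x) (\<lambda>x. g s x - g0 x) + L2_inner \<Omega> (\<lambda>x. f s x - f0 x) g0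
         + L2_inner \<Omega> f0 (\<lambda>x. g s x - g0 x)"
        using m d by (simp only: L2_inner_diff_left L2_inner_diff_right)
      then show ?case
        using L2_Cauchy_Schwarz[OF d] L2_Cauchy_Schwarz[OF d(1) m(4)] L2_Cauchy_Schwarz[OF m(3) d(2)]
        by simp
    qed
  qed
qed

section \<open>Smooth bump functions\<close>

lemma C_k_on_SucD:
  assumes "C_k_on (Suc k) S f"
  shows "C_k_on k S f"
  using assms
proof (induction k arbitrary: f)
  case 0
  then show ?case
    using differentiable_imp_continuous_on[of f S]
    by (auto simp: differentiable_on_def intro: differentiable_at_withinI)
qed auto

text \<open>Uniqueness of the derivative lets any explicit formula \<open>f'\<close> replace
  \<open>frechet_derivative\<close>, so the recursion can be run with the sum, product and chain
  rules.\<close>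

lemma C_k_on_UNIV_SucI:
  assumes "\<And>x. (f has_derivative f' x) (at x)" "\<And>v. C_k_on k UNIV (\<lambda>x. f' x v)"
  shows "C_k_on (Suc k) UNIV f"
proof -
  have "frechet_derivative f (at x) = f' x" for x
    using frechet_derivative_at[OF assms(1)] by simp
  then show ?thesis using assms by (auto simp: differentiable_def)
qed

lemma C_k_on_UNIV_SucE:
  assumes "C_k_on (Suc k) UNIV f"
  shows "(f has_derivative frechet_derivative f (at x)) (at x)"
    and "C_k_on k UNIV (\<lambda>x. frechet_derivative f (at x) v)"
  using assms by (auto simp: frechet_derivative_works)

lemma C_k_on_const: "C_k_on k UNIV (\<lambda>x::'a::euclidean_space. r)"
proof (induction k arbitrary: r)
  case (Suc k)
  show ?case by (rule C_k_on_UNIV_SucI[where f' = "\<lambda>x v. 0"]) (auto intro: Suc)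
qed simp

lemma C_k_on_add:
  assumes "C_k_on k UNIV f" "C_k_on k UNIV g"
  shows "C_k_on k UNIV (\<lambda>x. f x + g x)"
  using assms
proof (induction k arbitrary: f g)
  case (Suc k)
  note f = C_k_on_UNIV_SucE[OF Suc.prems(1)] and g = C_k_on_UNIV_SucE[OF Suc.prems(2)]
  show ?case
    by (rule C_k_on_UNIV_SucI, rule has_derivative_add[OF f(1) g(1)], rule Suc.IH[OF f(2) g(2)])
qed (auto intro: continuous_intros)

lemma C_k_on_mult:
  assumes "C_k_on k UNIV f" "C_k_on k UNIV g"
  shows "C_k_on k UNIV (\<lambda>x. f x * g x)"
  using assms
proof (induction k arbitrary: f g)
  case (Suc k)
  note f = C_k_on_UNIV_SucE[OF Suc.prems(1)] and g = C_k_on_UNIV_SucE[OF Suc.prems(2)]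
  show ?case
    by (rule C_k_on_UNIV_SucI, rule has_derivative_mult[OF f(1) g(1)])
      (intro C_k_on_add Suc.IH f g C_k_on_SucD[OF Suc.prems(1)] C_k_on_SucD[OF Suc.prems(2)])
qed (auto intro: continuous_intros)

lemma C_k_on_prod:
  assumes "\<And>i. i \<in> I \<Longrightarrow> C_k_on k UNIV (f i)"
  shows "C_k_on k UNIV (\<lambda>x. \<Prod>i\<in>I. f i x)"
  using assms by (induction I rule: infinite_finite_induct) (auto intro: C_k_on_const C_k_on_mult)

text \<open>The classical flat function exp(-m/t), extended by 0, with a polynomial in 1/t as
  prefactor. The prefactor makes the class closed under differentiation, so one derivative formula
  yields smoothness of every order.\<close>

definition exp_poly :: "real \<Rightarrow> real poly \<Rightarrow> real \<Rightarrow> real" where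
  "exp_poly m p t = (if t > 0 then poly p (1 / t) * exp (- m / t) else 0)"

lemma tendsto_poly_mult_exp_at_top:
  fixes p :: "real poly"
  assumes "m > 0"
  shows "((\<lambda>y. poly p y * exp (- m * y)) \<longlongrightarrow> 0) at_top"
proof -
  have *: "((\<lambda>y::real. y ^ k * exp (- m * y)) \<longlongrightarrow> 0) at_top" for k
  proof -
    have "((\<lambda>y. (1 / m ^ k) * ((m * y) ^ k / exp (m * y))) \<longlongrightarrow> (1 / m ^ k) * 0) at_top"
      by (intro tendsto_mult tendsto_const filterlim_compose[OF tendsto_power_div_exp_0]
          filterlim_tendsto_pos_mult_at_top[OF tendsto_const assms] filterlim_ident)
    then show ?thesis using assms by (simp add: power_mult_distrib exp_minus field_simps)
  qed
  \<comment> \<open>The extra power of \<open>y\<close> makes the induction on coefficients go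
    through: \<open>pCons\<close> multiplies the tail by \<open>y\<close>, which raises
    \<open>k\<close> by one.\<close>
  have "((\<lambda>y. y ^ k * poly p y * exp (- m * y)) \<longlongrightarrow> 0) at_top" for k
  proof (induction p arbitrary: k)
    case (pCons a p)
    have "((\<lambda>y. a * (y ^ k * exp (- m * y)) + y ^ Suc k * poly p y * exp (- m * y)) \<longlongrightarrow> a * 0 + 0) at_top"
      by (intro tendsto_add tendsto_mult tendsto_const * pCons)
    then show ?case by (simp add: algebra_simps)
  qed simp
  from this[of 0] show ?thesis by simp
qed

text \<open>For t > 0 the derivative is t^(-2) (m p - p')(1/t) exp(-m/t), and
  \<open>[:0, 0, 1:]\<close> is the factor t^(-2) seen as a polynomial in 1/t. Only the point t = 0
  needs a limit.\<close>

lemma exp_poly_has_derivative: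
  assumes m: "m > 0"
  shows "(exp_poly m p has_real_derivative exp_poly m ([:0, 0, 1:] * (smult m p - pderiv p)) t) (at t)"
proof -
  consider "t > 0" | "t < 0" | "t = 0" by linarith
  then show ?thesis
  proof cases
    case 1
    have "((\<lambda>t. poly p (1 / t) * exp (- m / t)) has_real_derivative
        exp_poly m ([:0, 0, 1:] * (smult m p - pderiv p)) t) (at t)"
      using 1 by (auto intro!: derivative_eq_intros DERIV_chain2[OF poly_DERIV]
          simp: exp_poly_def field_simps power2_eq_square)
    moreover have "eventually (\<lambda>s. exp_poly m p s = poly p (1 / s) * exp (- m / s)) (nhds t)"
      using eventually_nhds_in_open[of "{0<..}" t] 1 by (auto elim!: eventually_mono simp: exp_poly_def)
    ultimately show ?thesis
      by (subst DERIV_cong_ev[OF refl _ refl])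
  next
    case 2
    have "eventually (\<lambda>s. exp_poly m p s = 0) (nhds t)"
      using eventually_nhds_in_open[of "{..<0}" t] 2 by (auto elim!: eventually_mono simp: exp_poly_def)
    moreover have "((\<lambda>t. 0) has_real_derivative
        exp_poly m ([:0, 0, 1:] * (smult m p - pderiv p)) t) (at t)"
      using 2 by (simp add: exp_poly_def)
    ultimately show ?thesis
      by (subst DERIV_cong_ev[OF refl _ refl])
  next
    case 3
    \<comment> \<open>Dividing by \<open>h\<close> turns p(y) into y p(y) at y = 1/h, which is
      \<open>pCons 0 p\<close>; hence the difference quotient at 0 is covered by the limit at
      infinity.\<close>
    have "((\<lambda>h. poly (pCons 0 p) (inverse h) * exp (- m * inverse h)) \<longlongrightarrow> 0) (at_right 0)"
      by (rule filterlim_compose[OF tendsto_poly_mult_exp_at_top[OF m] filterlim_inverse_at_top_right])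
    then have "((\<lambda>h. exp_poly m p h / h) \<longlongrightarrow> 0) (at_right 0)"
      by (rule Lim_transform_eventually)
        (auto simp: exp_poly_def eventually_at_filter field_simps)
    moreover have "((\<lambda>h. exp_poly m p h / h) \<longlongrightarrow> 0) (at_left 0)"
      by (rule Lim_transform_eventually[OF tendsto_const])
        (auto simp: exp_poly_def eventually_at_filter)
    ultimately have "((\<lambda>h. exp_poly m p h / h) \<longlongrightarrow> 0) (at 0)"
      by (intro filterlim_split_at)
    then show ?thesis using 3 by (simp add: DERIV_def exp_poly_def)
  qed
qed

text \<open>The polynomial stays arbitrary in the induction since each derivative changes it.
  Composition with a general affine form covers the distances to both opposite faces of a
  box.\<close>

lemma C_k_on_exp_poly_affine:
  fixes w :: "'a::euclidean_space"
  assumes "m > 0"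
  shows "C_k_on k UNIV (\<lambda>x. exp_poly m p (x \<bullet> w + a))"
proof (induction k arbitrary: p)
  case 0
  have "continuous_on UNIV (exp_poly m p)"
    using exp_poly_has_derivative[OF assms]
    by (meson DERIV_isCont continuous_at_imp_continuous_on)
  then have "continuous_on UNIV (\<lambda>x::'a. exp_poly m p (x \<bullet> w + a))"
    by (rule continuous_on_compose2) (auto intro!: continuous_intros)
  then show ?case by simp
next
  case (Suc k)
  let ?q = "[:0, 0, 1:] * (smult m p - pderiv p)"
  show ?case
  proof (rule C_k_on_UNIV_SucI)
    fix x :: 'a
    have "((\<lambda>x. x \<bullet> w + a) has_derivative (\<lambda>v. v \<bullet> w)) (at x)"
      by (auto intro!: derivative_eq_intros)
    from has_derivative_compose[OF this exp_poly_has_derivative[OF assms, of p, unfolded has_field_derivative_def]]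
    show "((\<lambda>x. exp_poly m p (x \<bullet> w + a)) has_derivative
        (\<lambda>v. exp_poly m ?q (x \<bullet> w + a) * (v \<bullet> w))) (at x)" .
  next
    show "C_k_on k UNIV (\<lambda>x. exp_poly m ?q (x \<bullet> w + a) * (v \<bullet> w))" for v
      by (intro C_k_on_mult Suc.IH C_k_on_const)
  qed
qed

text \<open>Positive exactly on the open box; as \<open>m\<close> tends to 0 it increases to the indicator function.\<close>

definition box_bump :: "real \<Rightarrow> 'a::euclidean_space \<Rightarrow> 'a \<Rightarrow> 'a \<Rightarrow> real" where
  "box_bump m a b x = (\<Prod>i\<in>Basis. exp_poly m 1 (x \<bullet> i - a \<bullet> i) * exp_poly m 1 (b \<bullet> i - x \<bullet> i))"

lemma smooth_box_bump:
  assumes "m > 0"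
  shows "smooth_on UNIV (box_bump m a b)"
proof -
  have "C_k_on k UNIV (\<lambda>x. \<Prod>i\<in>Basis. exp_poly m 1 (x \<bullet> i + (- (a \<bullet> i))) *
      exp_poly m 1 (x \<bullet> (- i) + b \<bullet> i))" for k
    by (intro C_k_on_prod C_k_on_mult C_k_on_exp_poly_affine assms)
  then show ?thesis by (simp add: smooth_on_def box_bump_def[abs_def])
qed

lemma exp_poly_1_bounds: "m > 0 \<Longrightarrow> 0 \<le> exp_poly m 1 t" "m > 0 \<Longrightarrow> exp_poly m 1 t \<le> 1"
  by (auto simp: exp_poly_def)

lemma box_bump_bounds:
  assumes "m > 0"
  shows "0 \<le> box_bump m a b x" "box_bump m a b x \<le> 1"
  using assms unfolding box_bump_def
  by (auto intro!: prod_nonneg prod_le_1 mult_le_one exp_poly_1_bounds mult_nonneg_nonneg)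

lemma box_bump_eq_0: "x \<notin> box a b \<Longrightarrow> box_bump m a b x = 0"
  by (auto simp: box_bump_def mem_box exp_poly_def intro!: prod_zero)

lemma box_bump_test_fun:
  assumes "cbox a b \<subseteq> \<Omega>" "m > 0"
  shows "box_bump m a b \<in> test_fun \<Omega>"
proof -
  have "closure {x. box_bump m a b x \<noteq> 0} \<subseteq> cbox a b"
    using box_subset_cbox[of a b] by (intro closure_minimal) (auto dest: box_bump_eq_0)
  then show ?thesis
    using assms smooth_box_bump[OF assms(2)]
    by (auto simp: test_fun_def compact_eq_bounded_closed intro: bounded_subset[OF bounded_cbox])
qed

lemma tendsto_box_bump: "(\<lambda>n. box_bump (1 / real (Suc n)) a b x) \<longlonglongrightarrow> indicator (box a b) x"
proof (cases "x \<in> box a b")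
  case True
  have *: "(\<lambda>n. exp_poly (1 / real (Suc n)) 1 t) \<longlonglongrightarrow> 1" if "t > 0" for t
  proof -
    have "(\<lambda>n. exp (- (1 / real (Suc n)) / t)) \<longlonglongrightarrow> exp (- 0 / t)"
      by (intro tendsto_intros LIMSEQ_Suc[OF lim_1_over_n]) (use that in auto)
    then show ?thesis using that by (simp add: exp_poly_def)
  qed
  have "(\<lambda>n. box_bump (1 / real (Suc n)) a b x) \<longlonglongrightarrow> (\<Prod>i\<in>(Basis::'a set). 1 * 1)"
    unfolding box_bump_def
    by (intro tendsto_prod tendsto_mult *) (use True in \<open>auto simp: mem_box\<close>)
  then show ?thesis using True by simp
qed (simp add: box_bump_eq_0)

section \<open>Integration by parts for test functions\<close>

lemma partials_Nil [simp]: "partials [] \<phi> = \<phi>"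
  by (simp add: partials_def)

lemma partials_Cons: "partials (v # vs) \<phi> = (\<lambda>x. frechet_derivative (partials vs \<phi>) (at x) v)"
  by (simp add: partials_def)

lemma partials_append: "partials (vs @ ws) \<phi> = partials vs (partials ws \<phi>)"
  by (simp add: partials_def)

lemma smooth_on_UNIV_D:
  assumes "smooth_on UNIV \<phi>"
  shows "(\<phi> has_derivative frechet_derivative \<phi> (at x)) (at x)"
    and "smooth_on UNIV (\<lambda>x. frechet_derivative \<phi> (at x) v)"
    and "continuous_on UNIV \<phi>"
proof -
  have *: "C_k_on k UNIV \<phi>" for k
    using assms by (simp add: smooth_on_def)
  from C_k_on_UNIV_SucE[OF *]
  show "(\<phi> has_derivative frechet_derivative \<phi> (at x)) (at x)"
    and "smooth_on UNIV (\<lambda>x. frechet_derivative \<phi> (at x) v)"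
    by (auto simp: smooth_on_def)
  show "continuous_on UNIV \<phi>"
    using *[of 0] by simp
qed

lemma test_fun_outside:
  assumes "\<phi> \<in> test_fun \<Omega>" "x \<notin> \<Omega>"
  shows "\<phi> x = 0"
  using assms closure_subset[of "{x. \<phi> x \<noteq> 0}"] by (auto simp: test_fun_def)

lemma test_fun_partial:
  assumes "\<phi> \<in> test_fun \<Omega>"
  shows "(\<lambda>x. frechet_derivative \<phi> (at x) v) \<in> test_fun \<Omega>"
proof -
  let ?K = "closure {x. \<phi> x \<noteq> 0}"
  have "frechet_derivative \<phi> (at x) v = 0" if "x \<notin> ?K" for x
  proof -
    have "((\<lambda>x. 0) has_derivative (\<lambda>v. 0)) (at x)" by simp
    then have "(\<phi> has_derivative (\<lambda>v. 0)) (at x)"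
      by (rule has_derivative_transform_within_open[where s = "- ?K"])
        (use that closure_subset[of "{x. \<phi> x \<noteq> 0}"] in auto)
    then show ?thesis
      using frechet_derivative_at by metis
  qed
  then have sub: "closure {x. frechet_derivative \<phi> (at x) v \<noteq> 0} \<subseteq> ?K"
    by (intro closure_minimal) auto
  have "compact ?K" "?K \<subseteq> \<Omega>" "smooth_on UNIV \<phi>"
    using assms by (auto simp: test_fun_def)
  then show ?thesis
    using sub smooth_on_UNIV_D(2)[OF \<open>smooth_on UNIV \<phi>\<close>] bounded_subset[OF _ sub]
    by (auto simp: test_fun_def compact_eq_bounded_closed)
qed

lemma test_fun_partials: "\<phi> \<in> test_fun \<Omega> \<Longrightarrow> partials vs \<phi> \<in> test_fun \<Omega>"
  by (induction vs) (simp_all add: partials_Cons test_fun_partial)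

lemma test_fun_mult:
  assumes "\<phi> \<in> test_fun \<Omega>" "\<psi> \<in> test_fun \<Omega>"
  shows "(\<lambda>x. \<phi> x * \<psi> x) \<in> test_fun \<Omega>"
proof -
  have sub: "closure {x. \<phi> x * \<psi> x \<noteq> 0} \<subseteq> closure {x. \<phi> x \<noteq> 0}"
    by (intro closure_mono) auto
  have "smooth_on UNIV (\<lambda>x. \<phi> x * \<psi> x)"
    using assms by (auto simp: test_fun_def smooth_on_def intro: C_k_on_mult)
  then show ?thesis
    using assms(1) sub bounded_subset[OF _ sub] by (auto simp: test_fun_def compact_eq_bounded_closed)
qed

lemma test_fun_continuous: "\<phi> \<in> test_fun \<Omega> \<Longrightarrow> continuous_on UNIV \<phi>"
  by (simp add: test_fun_def smooth_on_UNIV_D)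

lemma test_fun_borel: "\<phi> \<in> test_fun \<Omega> \<Longrightarrow> \<phi> \<in> borel_measurable borel"
  by (simp add: borel_measurable_continuous_onI test_fun_continuous)

lemma test_fun_has_derivative:
  "\<phi> \<in> test_fun \<Omega> \<Longrightarrow> (\<phi> has_derivative frechet_derivative \<phi> (at x)) (at x)"
  by (simp add: test_fun_def smooth_on_UNIV_D)

lemma test_fun_bounded:
  assumes "\<phi> \<in> test_fun \<Omega>"
  shows "\<exists>B>0. \<forall>x. \<bar>\<phi> x\<bar> \<le> B"
proof -
  let ?K = "closure {x. \<phi> x \<noteq> 0}"
  have "compact ?K" using assms by (simp add: test_fun_def)
  then have "compact (\<phi> ` ?K)"
    by (intro compact_continuous_image continuous_on_subset[OF test_fun_continuous[OF assms]]) auto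
  then obtain B where B: "B > 0" "\<And>x. x \<in> ?K \<Longrightarrow> \<bar>\<phi> x\<bar> \<le> B"
    using compact_imp_bounded bounded_pos by (metis imageI real_norm_def)
  have "\<bar>\<phi> x\<bar> \<le> B" for x
    using B closure_subset[of "{x. \<phi> x \<noteq> 0}"] by (cases "\<phi> x = 0") auto
  with B(1) show ?thesis by blast
qed

lemma test_fun_L2:
  assumes "\<phi> \<in> test_fun \<Omega>" "open \<Omega>" "bounded \<Omega>"
  shows "\<phi> \<in> L2 \<Omega>"
proof -
  obtain B where B: "B > 0" "\<And>x. \<bar>\<phi> x\<bar> \<le> B"
    using test_fun_bounded[OF assms(1)] by blast
  interpret finite_measure "lebesgue_on \<Omega>"
    using assms by (intro finite_measure_lebesgue_on) (simp add: bounded_set_imp_lmeasurable)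
  have "\<phi> \<in> borel_measurable (lebesgue_on \<Omega>)"
    using test_fun_borel[OF assms(1)] by (intro measurable_restrict_space1 measurable_completion) simp
  moreover have "integrable (lebesgue_on \<Omega>) (\<lambda>x. (\<phi> x)\<^sup>2)"
    by (rule integrable_const_bound[where B = "B\<^sup>2"])
      (use B calculation in \<open>auto simp: abs_le_square_iff[symmetric]\<close>)
  ultimately show ?thesis by (simp add: L2_def)
qed

text \<open>Bridge between the integrals that define weak derivatives and \<open>lborel\<close>,
  where translation invariance is available.\<close>

lemma integral_lebesgue_on_borel:
  fixes f :: "'a::euclidean_space \<Rightarrow> real"
  assumes "\<And>x. x \<notin> \<Omega> \<Longrightarrow> f x = 0" "f \<in> borel_measurable borel" "\<Omega> \<in> sets lebesgue"
  shows "(LINT x|lebesgue_on \<Omega>. f x) = (LINT x|lborel. f x)"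
proof -
  have "(LINT x|lebesgue_on \<Omega>. f x) = (LINT x|lebesgue. indicator \<Omega> x *\<^sub>R f x)"
    using assms by (subst integral_restrict_space) auto
  also have "(\<lambda>x. indicator \<Omega> x *\<^sub>R f x) = f"
    using assms(1) by (auto simp: fun_eq_iff indicator_def)
  finally show ?thesis using assms by (simp add: integral_completion)
qed

lemma integral_translation:
  fixes f :: "'a::euclidean_space \<Rightarrow> real"
  assumes "f \<in> borel_measurable borel"
  shows "(LINT x|lborel. f (c + x)) = (LINT x|lborel. f x)"
proof -
  have "(LINT x|lborel. f x) = (LINT x|distr lborel borel ((+) c). f x)"
    by (simp add: lborel_distr_plus)
  also have "\<dots> = (LINT x|lborel. f (c + x))"
    using assms by (intro integral_distr) auto
  finally show ?thesis ..
qed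

text \<open>By translation invariance every difference quotient of \<open>F\<close> in direction
  \<open>v\<close> has integral 0; dominated convergence carries this over to the
  derivative.\<close>

lemma integral_partial_eq_0:
  assumes F: "F \<in> test_fun \<Omega>" and \<Omega>: "open \<Omega>"
  shows "(LINT x|lebesgue_on \<Omega>. frechet_derivative F (at x) v) = 0"
proof -
  define D where "D x = frechet_derivative F (at x) v" for x
  have D: "D \<in> test_fun \<Omega>"
    unfolding D_def by (rule test_fun_partial[OF F])
  obtain B where B: "B > 0" "\<And>x. \<bar>D x\<bar> \<le> B"
    using test_fun_bounded[OF D] by blast
  have "bounded {x. F x \<noteq> 0}"
    using F bounded_subset[OF _ closure_subset] by (auto simp: test_fun_def compact_eq_bounded_closed)
  then obtain R where R: "\<And>x. F x \<noteq> 0 \<Longrightarrow> norm x \<le> R"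
    by (auto simp: bounded_iff)
  have line: "((\<lambda>h. F (x + h *\<^sub>R v)) has_real_derivative D (x + h *\<^sub>R v)) (at h)" for x h
  proof -
    have "((\<lambda>h. x + h *\<^sub>R v) has_derivative (\<lambda>k. k *\<^sub>R v)) (at h)"
      by (auto intro!: derivative_eq_intros)
    from has_derivative_compose[OF this test_fun_has_derivative[OF F]]
    have "((\<lambda>h. F (x + h *\<^sub>R v)) has_derivative
        (\<lambda>k. frechet_derivative F (at (x + h *\<^sub>R v)) (k *\<^sub>R v))) (at h)" .
    moreover have "frechet_derivative F (at y) (k *\<^sub>R v) = D y * k" for y k
      using linear_scale[OF has_derivative_linear[OF test_fun_has_derivative[OF F]]]
      by (simp add: D_def mult.commute)
    ultimately show ?thesis by (simp add: has_field_derivative_def)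
  qed
  define h where "h n = 1 / real (Suc n)" for n
  have h: "0 < h n" "h n \<le> 1" for n by (auto simp: h_def)
  define Q where "Q n x = (F (x + h n *\<^sub>R v) - F x) / h n" for n x
  note [measurable] = test_fun_borel[OF F] test_fun_borel[OF D]
  have "(\<lambda>n. LINT x|lborel. Q n x) \<longlonglongrightarrow> (LINT x|lborel. D x)"
  \<comment> \<open>The mean value inequality along the line bounds the quotients by
    \<open>B\<close>. Steps of length at most 1 move the support by at most \<open>norm v\<close>,
    so all quotients live in one ball.\<close>
  proof (rule integral_dominated_convergence[where w = "\<lambda>x. B * indicator (cball 0 (R + norm v)) x"])
    show "integrable lborel (\<lambda>x::'a. B * indicator (cball 0 (R + norm v)) x)"
      by (intro integrable_mult_right integrable_real_indicator emeasure_bounded_finite) auto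
    have "(\<lambda>n. Q n x) \<longlonglongrightarrow> D x" for x
    proof -
      have "((\<lambda>h. (F (x + h *\<^sub>R v) - F x) / h) \<longlongrightarrow> D x) (at 0)"
        using line[of x 0] by (simp add: DERIV_def)
      moreover have "filterlim h (at 0) sequentially"
        unfolding filterlim_at h_def using LIMSEQ_Suc[OF lim_1_over_n] by auto
      ultimately show ?thesis
        unfolding Q_def by (rule filterlim_compose)
    qed
    then show "AE x in lborel. (\<lambda>n. Q n x) \<longlonglongrightarrow> D x" by simp
    have "\<bar>Q n x\<bar> \<le> B * indicator (cball 0 (R + norm v)) x" for n x
    proof (cases "norm x \<le> R + norm v")
      case True
      have "\<bar>F (x + h n *\<^sub>R v) - F (x + 0 *\<^sub>R v)\<bar> \<le> B * \<bar>h n - 0\<bar>"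
        by (rule field_differentiable_bound[of UNIV, where f' = "\<lambda>h. D (x + h *\<^sub>R v)", simplified])
          (use line B in auto)
      then show ?thesis using True h[of n] by (simp add: Q_def field_simps abs_mult)
    next
      case False
      have "norm (x + h n *\<^sub>R v) > R"
      proof -
        have "norm x \<le> norm (x + h n *\<^sub>R v) + norm (h n *\<^sub>R v)"
          using norm_triangle_ineq4[of "x + h n *\<^sub>R v" "h n *\<^sub>R v"] by simp
        moreover have "norm (h n *\<^sub>R v) \<le> norm v"
          using h[of n] by (simp add: mult_left_le_one_le)
        ultimately show ?thesis using False by simp
      qed
      moreover have "norm x > R" using False norm_ge_zero[of v] by linarith
      ultimately have "F (x + h n *\<^sub>R v) = 0" "F x = 0" using R by (meson not_le)+
      then show ?thesis using B(1) by (simp add: Q_def)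
    qed
    then show "AE x in lborel. norm (Q n x) \<le> B * indicator (cball 0 (R + norm v)) x" for n
      by simp
  qed (auto simp: Q_def)
  moreover have "(LINT x|lborel. Q n x) = 0" for n
  proof -
    have int: "integrable lborel F"
    proof -
      obtain B' where B': "B' > 0" "\<And>x. \<bar>F x\<bar> \<le> B'" using test_fun_bounded[OF F] by blast
      show ?thesis
      proof (rule Bochner_Integration.integrable_bound)
      show "integrable lborel (\<lambda>x::'a. B' * indicator (cball 0 R) x)"
        by (intro integrable_mult_right integrable_real_indicator emeasure_bounded_finite) auto
      show "AE x in lborel. norm (F x) \<le> norm (B' * indicator (cball 0 R) x)"
        using B' R by (auto simp: indicator_def)
      qed simp
    qed
    have "integrable lborel (\<lambda>x. F (h n *\<^sub>R v + x))"
    proof -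
      have "integrable (distr lborel borel ((+) (h n *\<^sub>R v))) F"
        using int by (simp add: lborel_distr_plus)
      then show ?thesis by (subst (asm) integrable_distr_eq) auto
    qed
    then have "(LINT x|lborel. F (h n *\<^sub>R v + x) - F x) = 0"
      using int integral_translation[of F "h n *\<^sub>R v"] by simp
    then show ?thesis by (simp add: Q_def add.commute)
  qed
  ultimately have "(LINT x|lborel. D x) = 0"
    by (simp add: LIMSEQ_const_iff)
  then show ?thesis
    using integral_lebesgue_on_borel[of \<Omega> D] \<Omega> test_fun_outside[OF D] test_fun_borel[OF D]
    by (simp add: D_def[abs_def])
qed

lemma test_fun_integral_by_parts:
  assumes \<phi>: "\<phi> \<in> test_fun \<Omega>" and \<psi>: "\<psi> \<in> test_fun \<Omega>" and \<Omega>: "open \<Omega>" "bounded \<Omega>"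
  shows "L2_inner \<Omega> \<phi> (\<lambda>x. frechet_derivative \<psi> (at x) v)
    = - L2_inner \<Omega> (\<lambda>x. frechet_derivative \<phi> (at x) v) \<psi>"
proof -
  have "frechet_derivative (\<lambda>x. \<phi> x * \<psi> x) (at x) v =
      \<phi> x * frechet_derivative \<psi> (at x) v + frechet_derivative \<phi> (at x) v * \<psi> x" for x
    using frechet_derivative_at[OF has_derivative_mult[OF test_fun_has_derivative[OF \<phi>]
      test_fun_has_derivative[OF \<psi>]], of x] by metis
  then have "0 = (LINT x|lebesgue_on \<Omega>.
      \<phi> x * frechet_derivative \<psi> (at x) v + frechet_derivative \<phi> (at x) v * \<psi> x)"
    using integral_partial_eq_0[OF test_fun_mult[OF \<phi> \<psi>] \<Omega>(1), of v] by simp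
  also have "\<dots> = L2_inner \<Omega> \<phi> (\<lambda>x. frechet_derivative \<psi> (at x) v)
      + L2_inner \<Omega> (\<lambda>x. frechet_derivative \<phi> (at x) v) \<psi>"
    unfolding L2_inner_def
    by (intro Bochner_Integration.integral_add L2_integrable_mult test_fun_L2 test_fun_partial \<phi> \<psi> \<Omega>)
  finally show ?thesis by simp
qed

section \<open>The fundamental lemma of the calculus of variations\<close>

text \<open>A Dynkin argument: open boxes are stable under intersection and generate the Borel sets,
  and the sets over which \<open>g\<close> integrates to 0 are closed under complements and disjoint
  countable unions.\<close>

lemma integral_borel_eq_0_if_boxes:
  fixes g :: "'a::euclidean_space \<Rightarrow> real"
  assumes int: "integrable lborel g"
    and box: "\<And>a b. (LINT x|lborel. indicator (box a b) x * g x) = 0"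
    and A: "A \<in> sets borel"
  shows "(LINT x|lborel. indicator A x * g x) = 0"
proof -
  let ?I = "\<lambda>A. LINT x|lborel. indicator A x * g x"
  have I: "integrable lborel (\<lambda>x. indicator A x * g x)" if "A \<in> sets borel" for A
    using integrable_mult_indicator[OF _ int, of A] that by simp
  let ?G = "range (\<lambda>(a, b). box a b :: 'a set)"
  have sets: "sigma_sets UNIV ?G = sets borel"
    by (simp add: borel_eq_box)
  \<comment> \<open>The complement step needs the integral over the whole space, which is not a box;
    growing boxes exhaust it.\<close>
  have whole: "(LINT x|lborel. g x) = 0"
  proof -
    define B :: "nat \<Rightarrow> 'a set" where "B n = box (- real n *\<^sub>R One) (real n *\<^sub>R One)" for n
    have "(\<lambda>n. ?I (B n)) \<longlonglongrightarrow> (LINT x|lborel. g x)"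
    proof (rule integral_dominated_convergence[where w = "\<lambda>x. norm (g x)"])
      have "eventually (\<lambda>n. indicator (B n) x * g x = g x) sequentially" for x
      proof -
        obtain N :: nat where N: "norm x < N" using reals_Archimedean2 by blast
        have "x \<in> B n" if "n \<ge> N" for n
        proof -
          have "\<bar>x \<bullet> i\<bar> < n" if "i \<in> Basis" for i
            using Basis_le_norm[OF that, of x] N \<open>n \<ge> N\<close> by linarith
          then show ?thesis by (auto simp: B_def mem_box abs_less_iff minus_less_iff)
        qed
        then show ?thesis unfolding eventually_sequentially by (intro exI[of _ N]) simp
      qed
      then show "AE x in lborel. (\<lambda>n. indicator (B n) x * g x) \<longlonglongrightarrow> g x"
        by (intro AE_I2 tendsto_eventually)
    qed (use int I in \<open>auto simp: B_def indicator_def\<close>)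
    then show ?thesis by (simp add: B_def box LIMSEQ_const_iff)
  qed
  have "Int_stable ?G"
    by (auto simp: Int_stable_def box_Int_box)
  moreover have "?G \<subseteq> Pow UNIV" by simp
  moreover have "A \<in> sigma_sets UNIV ?G" using A sets by simp
  ultimately show ?thesis
  proof (induction rule: sigma_sets_induct_disjoint)
    case (basic A)
    then show ?case using box by auto
  next
    case empty
    then show ?case by simp
  next
    case (compl A)
    then have "A \<in> sets borel" using sets by simp
    then have "?I (UNIV - A) = (LINT x|lborel. g x - indicator A x * g x)"
      by (intro Bochner_Integration.integral_cong) (auto simp: indicator_def)
    also have "\<dots> = 0"
      using int I[OF \<open>A \<in> sets borel\<close>] whole compl by simp
    finally show ?case .
  next
    case (union A)
    then have A: "range A \<subseteq> sets borel" using sets by auto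
    have "?I (\<Union>i. A i) = (LINT x:(\<Union>i. A i)|lborel. g x)"
      by (simp add: set_lebesgue_integral_def)
    also have "\<dots> = (\<Sum>i. LINT x:A i|lborel. g x)"
    proof (rule lebesgue_integral_countable_add)
      show "A i \<in> sets lborel" for i using A by auto
      show "A i \<inter> A j = {}" if "i \<noteq> j" for i j
        using union(1) that by (auto simp: disjoint_family_on_def)
      show "set_integrable lborel (\<Union>i. A i) g"
        using I[of "\<Union>i. A i"] A by (auto simp: set_integrable_def)
    qed
    also have "\<dots> = 0"
      using union(3) by (simp add: set_lebesgue_integral_def)
    finally show ?case .
  qed
qed

text \<open>Integrating over the set where \<open>g\<close> is positive forces it to be null; the
  same for \<open>- g\<close>.\<close>

lemma AE_eq_0_if_integral_boxes:
  fixes g :: "'a::euclidean_space \<Rightarrow> real"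
  assumes int: "integrable lborel g"
    and box: "\<And>a b. (LINT x|lborel. indicator (box a b) x * g x) = 0"
  shows "AE x in lborel. g x = 0"
proof -
  have [measurable]: "g \<in> borel_measurable borel" using int by auto
  have "AE x in lborel. \<not> g x > 0" if "integrable lborel g" "g \<in> borel_measurable borel"
    "\<And>A. A \<in> sets borel \<Longrightarrow> (LINT x|lborel. indicator A x * g x) = 0" for g :: "'a \<Rightarrow> real"
  proof -
    note [measurable] = that(2)
    let ?A = "{x. g x > 0}"
    have A: "?A \<in> sets borel" by measurable
    have "integrable lborel (\<lambda>x. indicator ?A x * g x)"
      using integrable_mult_indicator[OF _ that(1), of ?A] A by simp
    then have "AE x in lborel. indicator ?A x * g x = 0"
      using integral_nonneg_eq_0_iff_AE[of lborel "\<lambda>x. indicator ?A x * g x"] that(3)[OF A]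
      by (auto simp: indicator_def)
    then show ?thesis by (auto simp: indicator_def split: if_splits)
  qed
  from this[of g] this[of "\<lambda>x. - g x"] integral_borel_eq_0_if_boxes[OF int box] int
  have "AE x in lborel. \<not> g x > 0" "AE x in lborel. \<not> - g x > 0" by auto
  then show ?thesis by eventually_elim auto
qed

text \<open>Bump functions increase to indicators, so \<open>f\<close> integrates to 0 over each box
  whose closed box lies in \<open>\<Omega>\<close>. This makes \<open>f\<close> vanish almost
  everywhere on each such closed box, and countably many of them cover
  \<open>\<Omega>\<close>.\<close>

lemma L2_AE_eq_0_if_test_fun:
  fixes f :: "'a::euclidean_space \<Rightarrow> real"
  assumes \<Omega>: "open \<Omega>" "bounded \<Omega>" and f: "f \<in> L2 \<Omega>"
    and orth: "\<And>\<phi>. \<phi> \<in> test_fun \<Omega> \<Longrightarrow> L2_inner \<Omega> f \<phi> = 0"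
  shows "AE x in lebesgue_on \<Omega>. f x = 0"
proof -
  interpret finite_measure "lebesgue_on \<Omega>"
    using \<Omega> by (intro finite_measure_lebesgue_on) (simp add: bounded_set_imp_lmeasurable)
  have \<Omega>_sets: "\<Omega> \<inter> space lebesgue \<in> sets lebesgue" using \<Omega> by auto
  \<comment> \<open>The finite measure of \<open>\<Omega>\<close> makes \<open>f\<close> integrable,
    so its extension by 0 has an integrable Borel representative \<open>g\<close>.\<close>
  have "(\<lambda>x. 1) \<in> L2 \<Omega>" by (simp add: L2_def)
  from L2_integrable_mult[OF f this] have f_int: "integrable lebesgue (\<lambda>x. indicator \<Omega> x * f x)"
    by (subst (asm) integrable_restrict_space[OF \<Omega>_sets]) simp
  obtain g where g [measurable]: "g \<in> borel_measurable lborel"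
    and fg: "AE x in lborel. indicator \<Omega> x * f x = g x"
    using completion_ex_borel_measurable_real[OF borel_measurable_integrable[OF f_int]] by (elim bexE)
  have fg': "AE x in lebesgue. indicator \<Omega> x * f x = g x"
    using fg by (rule AE_completion)
  have "integrable lebesgue g"
    using integrable_cong_AE[OF borel_measurable_integrable[OF f_int] measurable_completion[OF g] fg'] f_int
    by (rule iffD1)
  then have int: "integrable lborel g"
    unfolding integrable_completion[OF g] .
  have test: "(LINT x|lborel. \<phi> x * g x) = 0" if "\<phi> \<in> test_fun \<Omega>" for \<phi>
  proof -
    note [measurable] = test_fun_borel[OF that]
    have "0 = (LINT x|lebesgue. indicator \<Omega> x *\<^sub>R (f x * \<phi> x))"
      using orth[OF that] unfolding L2_inner_def integral_restrict_space[OF \<Omega>_sets] by simp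
    also have "\<dots> = (LINT x|lebesgue. \<phi> x * g x)"
    proof (rule integral_cong_AE)
      show "(\<lambda>x. indicator \<Omega> x *\<^sub>R (f x * \<phi> x)) \<in> borel_measurable lebesgue"
        using borel_measurable_times[OF borel_measurable_integrable[OF f_int]
          measurable_completion[of \<phi> lborel borel]] by (simp add: mult.assoc)
      show "(\<lambda>x. \<phi> x * g x) \<in> borel_measurable lebesgue"
        by (rule measurable_completion) measurable
      show "AE x in lebesgue. indicator \<Omega> x *\<^sub>R (f x * \<phi> x) = \<phi> x * g x"
        using fg'
      proof eventually_elim
        case (elim x)
        show ?case unfolding elim[symmetric] by (simp add: mult_ac)
      qed
    qed
    finally show ?thesis by (simp add: integral_completion)
  qed
  have box: "(LINT x|lborel. indicator (box a b) x * g x) = 0" if "cbox a b \<subseteq> \<Omega>" for a b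
  proof -
    have "(\<lambda>n. LINT x|lborel. box_bump (1 / real (Suc n)) a b x * g x) \<longlonglongrightarrow>
        (LINT x|lborel. indicator (box a b) x * g x)"
    proof (rule integral_dominated_convergence[where w = "\<lambda>x. norm (g x)"])
      have "box_bump (1 / real (Suc n)) a b \<in> borel_measurable borel" for n
        using that by (intro test_fun_borel box_bump_test_fun) auto
      then show "(\<lambda>x. box_bump (1 / real (Suc n)) a b x * g x) \<in> borel_measurable lborel" for n
        by measurable
      show "AE x in lborel. norm (box_bump (1 / real (Suc n)) a b x * g x) \<le> norm (g x)" for n
        using box_bump_bounds[of "1 / real (Suc n)" a b]
        by (intro AE_I2) (simp add: abs_mult mult_left_le_one_le)
      show "AE x in lborel. (\<lambda>n. box_bump (1 / real (Suc n)) a b x * g x) \<longlonglongrightarrow>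
          indicator (box a b) x * g x"
        by (intro AE_I2 tendsto_mult tendsto_box_bump tendsto_const)
    qed (use int in auto)
    then show ?thesis
      using test[OF box_bump_test_fun[OF that]] by (simp add: LIMSEQ_const_iff)
  qed
  have null: "AE x in lborel. x \<in> cbox a b \<longrightarrow> g x = 0" if ab: "cbox a b \<subseteq> \<Omega>" for a b
  proof -
    have "integrable lborel (\<lambda>x. indicator (box a b) x * g x)"
      using integrable_mult_indicator[OF _ int, of "box a b"] by simp
    \<comment> \<open>The function cut off to \<open>box a b\<close> is tested against arbitrary
      boxes. Intersecting with \<open>box a b\<close> gives a box whose closed box, having the same
      corners, is still inside \<open>\<Omega>\<close>.\<close>
    moreover have "(LINT x|lborel. indicator (box p q) x * (indicator (box a b) x * g x)) = 0" for p q
    proof -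
      obtain p' q' where pq: "box p q \<inter> box a b = box p' q'" "cbox p q \<inter> cbox a b = cbox p' q'"
        using box_Int_box[of p q a b] Int_interval[of p q a b] by (rule that)
      then have "cbox p' q' \<subseteq> \<Omega>" using ab by blast
      from box[OF this] show ?thesis
        by (simp add: pq(1)[symmetric] indicator_inter_arith mult.assoc)
    qed
    ultimately have "AE x in lborel. indicator (box a b) x * g x = 0"
      by (rule AE_eq_0_if_integral_boxes)
    \<comment> \<open>The countable cover below consists of closed boxes, while only open ones have
      been treated; the faces are null.\<close>
    moreover have "AE x in lborel. x \<notin> cbox a b - box a b"
    proof (rule AE_not_in)
      have "negligible (cbox a b - box a b)" by (rule negligible_frontier_interval)
      then show "cbox a b - box a b \<in> null_sets lborel"
        by (simp add: negligible_iff_null_sets null_sets_completion_iff)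
    qed
    ultimately show ?thesis by eventually_elim (auto simp: indicator_def)
  qed
  obtain \<D> where \<D>: "countable \<D>" "\<D> \<subseteq> Pow \<Omega>" "\<And>X. X \<in> \<D> \<Longrightarrow> \<exists>a b. X = cbox a b" "\<Union>\<D> = \<Omega>"
    by (metis open_countable_Union_open_cbox[OF \<Omega>(1)])
  have "AE x in lborel. \<forall>X\<in>\<D>. x \<in> X \<longrightarrow> g x = 0"
  proof (subst AE_ball_countable[OF \<D>(1)], rule ballI)
    fix X assume "X \<in> \<D>"
    then show "AE x in lborel. x \<in> X \<longrightarrow> g x = 0"
      using \<D>(2) \<D>(3)[of X] null by auto
  qed
  then have "AE x in lborel. x \<in> \<Omega> \<longrightarrow> f x = 0"
    using fg by eventually_elim (use \<D>(4) in \<open>auto simp: indicator_def\<close>)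
  then have "AE x in lebesgue. x \<in> \<Omega> \<longrightarrow> f x = 0"
    by (rule AE_completion)
  then show ?thesis
    by (subst AE_restrict_space_iff[OF \<Omega>_sets])
qed

section \<open>Weak derivatives and the Laplacian\<close>

lemma has_weak_partials_iff:
  "has_weak_partials \<Omega> vs f g \<longleftrightarrow>
    (\<forall>\<phi>\<in>test_fun \<Omega>. L2_inner \<Omega> f (partials vs \<phi>) = (-1) ^ length vs * L2_inner \<Omega> g \<phi>)"
  by (simp add: has_weak_partials_def L2_inner_def)

lemma finite_indices: "finite (indices k :: 'a::euclidean_space list set)"
  unfolding indices_def by (rule finite_lists_length_le) simp

lemma L2_nrm_weak_partials_le_H_nrm:
  assumes "vs \<in> indices k"
  shows "L2_nrm \<Omega> (weak_partials \<Omega> vs f) \<le> H_nrm k \<Omega> f"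
  unfolding H_nrm_def
  by (rule real_le_rsqrt)
    (rule member_le_sum[OF assms, of "\<lambda>vs. (L2_nrm \<Omega> (weak_partials \<Omega> vs f))\<^sup>2"],
     simp_all add: finite_indices)

lemma H_L2: "f \<in> H k \<Omega> \<Longrightarrow> f \<in> L2 \<Omega>"
  by (simp add: H_def)

lemma H_mono: "f \<in> H k \<Omega> \<Longrightarrow> j \<le> k \<Longrightarrow> f \<in> H j \<Omega>"
  by (auto simp: H_def indices_def)

lemma
  assumes "f \<in> H k \<Omega>" "vs \<in> indices k"
  shows weak_partials_L2: "weak_partials \<Omega> vs f \<in> L2 \<Omega>"
    and has_weak_partials: "has_weak_partials \<Omega> vs f (weak_partials \<Omega> vs f)"
proof -
  have "\<exists>g. g \<in> L2 \<Omega> \<and> has_weak_partials \<Omega> vs f g"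
    using assms by (auto simp: H_def)
  from someI_ex[OF this]
  show "weak_partials \<Omega> vs f \<in> L2 \<Omega>" "has_weak_partials \<Omega> vs f (weak_partials \<Omega> vs f)"
    by (simp_all add: weak_partials_def)
qed

lemma L2_inner_weak_partials:
  assumes "f \<in> H k \<Omega>" "vs \<in> indices k" "\<phi> \<in> test_fun \<Omega>"
  shows "L2_inner \<Omega> f (partials vs \<phi>) = (-1) ^ length vs * L2_inner \<Omega> (weak_partials \<Omega> vs f) \<phi>"
  using has_weak_partials[OF assms(1,2)] assms(3) by (simp add: has_weak_partials_iff)

locale bounded_open =
  fixes \<Omega> :: "'a::euclidean_space set"
  assumes open_\<Omega>: "open \<Omega>" and bounded_\<Omega>: "bounded \<Omega>"
begin

lemmas test_L2 = test_fun_L2[OF _ open_\<Omega> bounded_\<Omega>]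

lemma has_weak_partials_add:
  assumes "f \<in> L2 \<Omega>" "f' \<in> L2 \<Omega>" "g \<in> L2 \<Omega>" "g' \<in> L2 \<Omega>"
    and "has_weak_partials \<Omega> vs f g" "has_weak_partials \<Omega> vs f' g'"
  shows "has_weak_partials \<Omega> vs (\<lambda>x. f x + f' x) (\<lambda>x. g x + g' x)"
  using assms
  by (simp add: has_weak_partials_iff L2_inner_add_left test_L2 test_fun_partials distrib_left)

lemma has_weak_partials_cmult:
  assumes "has_weak_partials \<Omega> vs f g"
  shows "has_weak_partials \<Omega> vs (\<lambda>x. r * f x) (\<lambda>x. r * g x)"
  using assms by (simp add: has_weak_partials_iff L2_inner_cmult_left)

text \<open>Two weak derivatives differ by something orthogonal to all test functions. This
  uniqueness makes the \<open>SOME\<close> in \<open>weak_partials\<close> usable: linearity and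
  agreement with classical derivatives are all derived through it.\<close>

lemma weak_partials_AE_eq:
  assumes f: "f \<in> H k \<Omega>" "vs \<in> indices k" and g: "g \<in> L2 \<Omega>" "has_weak_partials \<Omega> vs f g"
  shows "AE x in lebesgue_on \<Omega>. weak_partials \<Omega> vs f x = g x"
proof -
  note w = weak_partials_L2[OF f]
  have "AE x in lebesgue_on \<Omega>. weak_partials \<Omega> vs f x - g x = 0"
  proof (rule L2_AE_eq_0_if_test_fun[OF open_\<Omega> bounded_\<Omega> L2_diff[OF w g(1)]])
    fix \<phi> assume \<phi>: "\<phi> \<in> test_fun \<Omega>"
    then have "(-1) ^ length vs * L2_inner \<Omega> (weak_partials \<Omega> vs f) \<phi> = (-1) ^ length vs * L2_inner \<Omega> g \<phi>"
      using L2_inner_weak_partials[OF f \<phi>] g(2) by (simp add: has_weak_partials_iff)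
    then show "L2_inner \<Omega> (\<lambda>x. weak_partials \<Omega> vs f x - g x) \<phi> = 0"
      using L2_inner_diff_left[OF w g(1) test_L2[OF \<phi>]] by simp
  qed
  then show ?thesis by simp
qed

lemma H_add:
  assumes "f \<in> H k \<Omega>" "g \<in> H k \<Omega>"
  shows "(\<lambda>x. f x + g x) \<in> H k \<Omega>"
  using assms unfolding H_def by (blast intro: L2_add has_weak_partials_add)

lemma H_cmult:
  assumes "f \<in> H k \<Omega>"
  shows "(\<lambda>x. r * f x) \<in> H k \<Omega>"
  using assms unfolding H_def by (blast intro: L2_cmult has_weak_partials_cmult)

lemma H_zero: "(\<lambda>x. 0) \<in> H k \<Omega>"
  unfolding H_def by (auto intro!: L2_zero bexI[of _ "\<lambda>x. 0"] simp: has_weak_partials_def)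

lemma H_diff:
  assumes "f \<in> H k \<Omega>" "g \<in> H k \<Omega>"
  shows "(\<lambda>x. f x - g x) \<in> H k \<Omega>"
  using H_add[OF assms(1) H_cmult[OF assms(2), of "-1"]] by simp

lemma H_sum:
  assumes "\<And>i. i \<in> I \<Longrightarrow> f i \<in> H k \<Omega>"
  shows "(\<lambda>x. \<Sum>i\<in>I. f i x) \<in> H k \<Omega>"
  using assms by (induction I rule: infinite_finite_induct) (auto intro: H_zero H_add)

lemma weak_partials_add:
  assumes "f \<in> H k \<Omega>" "g \<in> H k \<Omega>" "vs \<in> indices k"
  shows "AE x in lebesgue_on \<Omega>. weak_partials \<Omega> vs (\<lambda>x. f x + g x) x
    = weak_partials \<Omega> vs f x + weak_partials \<Omega> vs g x"
  using assms
  by (intro weak_partials_AE_eq[OF H_add] L2_add has_weak_partials_add)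
    (auto intro: weak_partials_L2 has_weak_partials H_L2)

lemma weak_partials_cmult:
  assumes "f \<in> H k \<Omega>" "vs \<in> indices k"
  shows "AE x in lebesgue_on \<Omega>. weak_partials \<Omega> vs (\<lambda>x. r * f x) x = r * weak_partials \<Omega> vs f x"
  using assms
  by (intro weak_partials_AE_eq[OF H_cmult] L2_cmult has_weak_partials_cmult)
    (auto intro: weak_partials_L2 has_weak_partials H_L2)

lemma weak_partials_diff:
  assumes "f \<in> H k \<Omega>" "g \<in> H k \<Omega>" "vs \<in> indices k"
  shows "AE x in lebesgue_on \<Omega>. weak_partials \<Omega> vs (\<lambda>x. f x - g x) x
    = weak_partials \<Omega> vs f x - weak_partials \<Omega> vs g x"
  using weak_partials_add[OF assms(1) H_cmult[OF assms(2), of "-1"] assms(3)]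
    weak_partials_cmult[OF assms(2,3), of "-1"]
  by eventually_elim simp

lemma weak_partials_Nil:
  assumes "f \<in> H k \<Omega>"
  shows "AE x in lebesgue_on \<Omega>. weak_partials \<Omega> [] f x = f x"
  using assms
  by (intro weak_partials_AE_eq H_L2) (auto simp: indices_def has_weak_partials_def)

lemma test_fun_has_weak_partials:
  assumes \<phi>: "\<phi> \<in> test_fun \<Omega>"
  shows "has_weak_partials \<Omega> [v] \<phi> (partials [v] \<phi>)"
  using test_fun_integral_by_parts[OF \<phi> _ open_\<Omega> bounded_\<Omega>]
  by (simp add: has_weak_partials_iff partials_Cons)

lemma test_fun_H1:
  assumes \<phi>: "\<phi> \<in> test_fun \<Omega>"
  shows "\<phi> \<in> H 1 \<Omega>"
proof -
  have "\<exists>g\<in>L2 \<Omega>. has_weak_partials \<Omega> vs \<phi> g" if "vs \<in> indices 1" for vs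
  proof (cases vs)
    case Nil
    then show ?thesis using \<phi> by (intro bexI[of _ \<phi>]) (auto simp: has_weak_partials_def test_L2)
  next
    case (Cons v ws)
    then have "vs = [v]" using that by (simp add: indices_def)
    then show ?thesis
      using test_fun_has_weak_partials[OF \<phi>] test_L2[OF test_fun_partials[OF \<phi>]] by blast
  qed
  then show ?thesis using \<phi> by (simp add: H_def test_L2)
qed

lemma weak_partials_test_fun:
  assumes "\<phi> \<in> test_fun \<Omega>" "v \<in> Basis"
  shows "AE x in lebesgue_on \<Omega>. weak_partials \<Omega> [v] \<phi> x = partials [v] \<phi> x"
  by (rule weak_partials_AE_eq[where k = 1])
    (use assms in \<open>auto simp: indices_def simp del: One_nat_def intro: test_fun_H1 test_L2 test_fun_partials test_fun_has_weak_partials\<close>)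

text \<open>Splits convergence in \<open>H_nrm 1\<close> into its components, the empty index giving
  the function itself, and replaces the weak derivatives of the approximants by classical
  ones.\<close>

lemma H10_approx:
  assumes g: "g \<in> H10 \<Omega>"
  shows "\<exists>\<phi>. (\<forall>n::nat. \<phi> n \<in> test_fun \<Omega>) \<and>
    (\<lambda>n. L2_nrm \<Omega> (\<lambda>x. \<phi> n x - g x)) \<longlonglongrightarrow> 0 \<and>
    (\<forall>v\<in>Basis. (\<lambda>n. L2_nrm \<Omega> (\<lambda>x. partials [v] (\<phi> n) x - weak_partials \<Omega> [v] g x)) \<longlonglongrightarrow> 0)"
proof -
  from g obtain \<phi> where gH: "g \<in> H 1 \<Omega>" and \<phi>: "\<And>n::nat. \<phi> n \<in> test_fun \<Omega>"
    and lim: "(\<lambda>n. H_nrm 1 \<Omega> (\<lambda>x. g x - \<phi> n x)) \<longlonglongrightarrow> 0"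
    by (auto simp: H10_def)
  note dH = H_diff[OF gH test_fun_H1[OF \<phi>]]
  have swap: "L2_nrm \<Omega> (\<lambda>x. p x - q x) = L2_nrm \<Omega> (\<lambda>x. q x - p x)" for p q
    by (simp add: L2_nrm_def power2_commute)
  have "(\<lambda>n. L2_nrm \<Omega> (weak_partials \<Omega> vs (\<lambda>x. g x - \<phi> n x))) \<longlonglongrightarrow> 0" if "vs \<in> indices 1" for vs
    by (rule tendsto_sandwich[OF _ _ tendsto_const lim])
      (intro always_eventually allI L2_nrm_nonneg L2_nrm_weak_partials_le_H_nrm[OF that])+
  note * = this
  have "L2_nrm \<Omega> (weak_partials \<Omega> [] (\<lambda>x. g x - \<phi> n x)) = L2_nrm \<Omega> (\<lambda>x. \<phi> n x - g x)" for n
    by (subst swap, rule L2_nrm_cong_AE)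
      (use dH[of n] in \<open>auto intro: weak_partials_L2 H_L2 weak_partials_Nil simp: indices_def\<close>)
  with *[of "[]"] have 1: "(\<lambda>n. L2_nrm \<Omega> (\<lambda>x. \<phi> n x - g x)) \<longlonglongrightarrow> 0"
    by (simp add: indices_def)
  have "(\<lambda>n. L2_nrm \<Omega> (\<lambda>x. partials [v] (\<phi> n) x - weak_partials \<Omega> [v] g x)) \<longlonglongrightarrow> 0" if v: "v \<in> Basis" for v
  proof -
    have vi: "[v] \<in> indices 1" using v by (simp add: indices_def)
    have "L2_nrm \<Omega> (weak_partials \<Omega> [v] (\<lambda>x. g x - \<phi> n x))
        = L2_nrm \<Omega> (\<lambda>x. partials [v] (\<phi> n) x - weak_partials \<Omega> [v] g x)" for n
    proof (subst swap, rule L2_nrm_cong_AE)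
      show "weak_partials \<Omega> [v] (\<lambda>x. g x - \<phi> n x) \<in> L2 \<Omega>"
        by (rule weak_partials_L2[OF dH vi])
      show "(\<lambda>x. weak_partials \<Omega> [v] g x - partials [v] (\<phi> n) x) \<in> L2 \<Omega>"
        by (intro L2_diff weak_partials_L2[OF gH vi] test_L2 test_fun_partials \<phi>)
      show "AE x in lebesgue_on \<Omega>. weak_partials \<Omega> [v] (\<lambda>x. g x - \<phi> n x) x
          = weak_partials \<Omega> [v] g x - partials [v] (\<phi> n) x"
        using weak_partials_diff[OF gH test_fun_H1[OF \<phi>[of n]] vi] weak_partials_test_fun[OF \<phi>[of n] v]
        by eventually_elim simp
    qed
    then show ?thesis using *[OF vi] by simp
  qed
  with \<phi> 1 show ?thesis by blast
qed

lemma lap_L2: "f \<in> H 2 \<Omega> \<Longrightarrow> lap \<Omega> f \<in> L2 \<Omega>"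
  unfolding lap_def by (intro L2_sum weak_partials_L2) (auto simp: indices_def)

text \<open>Against test functions the formula is the definition of weak derivatives; both sides are
  continuous in the H^1 norm, so it extends to their closure \<open>H10\<close>.\<close>

lemma weak_Green:
  assumes f: "f \<in> H 2 \<Omega>" and g: "g \<in> H10 \<Omega>"
  shows "L2_inner \<Omega> (lap \<Omega> f) g
    = - (\<Sum>v\<in>Basis. L2_inner \<Omega> (weak_partials \<Omega> [v] f) (weak_partials \<Omega> [v] g))"
proof -
  obtain \<phi> where \<phi>: "\<And>n::nat. \<phi> n \<in> test_fun \<Omega>"
    and 1: "(\<lambda>n. L2_nrm \<Omega> (\<lambda>x. \<phi> n x - g x)) \<longlonglongrightarrow> 0"
    and 2: "\<And>v. v \<in> Basis \<Longrightarrow>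
      (\<lambda>n. L2_nrm \<Omega> (\<lambda>x. partials [v] (\<phi> n) x - weak_partials \<Omega> [v] g x)) \<longlonglongrightarrow> 0"
    using H10_approx[OF g] by blast
  have gH: "g \<in> H 1 \<Omega>" using g by (simp add: H10_def)
  have "L2_inner \<Omega> (weak_partials \<Omega> [v, v] f) g = - L2_inner \<Omega> (weak_partials \<Omega> [v] f) (weak_partials \<Omega> [v] g)"
    if v: "v \<in> Basis" for v
  proof -
    have vi: "[v] \<in> indices 2" "[v, v] \<in> indices 2" "[v] \<in> indices 1" using v by (auto simp: indices_def)
    note wf = weak_partials_L2[OF f vi(1)] weak_partials_L2[OF f vi(2)] and wg = weak_partials_L2[OF gH vi(3)]
    \<comment> \<open>The integral of \<open>f\<close> against the second derivative of a test
      function is read in two ways: moving both derivatives onto \<open>f\<close>, or only one. The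
      minus sign comes from the second reading.\<close>
    have "L2_inner \<Omega> (weak_partials \<Omega> [v, v] f) (\<phi> n) = - L2_inner \<Omega> (weak_partials \<Omega> [v] f) (partials [v] (\<phi> n))" for n
      using L2_inner_weak_partials[OF f vi(2) \<phi>[of n]]
        L2_inner_weak_partials[OF f vi(1) test_fun_partials[OF \<phi>[of n], of "[v]"]]
        partials_append[of "[v]" "[v]" "\<phi> n"] by simp
    moreover have "(\<lambda>n. L2_inner \<Omega> (weak_partials \<Omega> [v, v] f) (\<phi> n)) \<longlonglongrightarrow> L2_inner \<Omega> (weak_partials \<Omega> [v, v] f) g"
      by (rule tendsto_L2_inner[where S = UNIV, OF _ _ _ _ _ _ 1])
        (auto intro: wf test_L2 \<phi> H_L2[OF gH] simp: L2_nrm_def)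
    moreover have "(\<lambda>n. - L2_inner \<Omega> (weak_partials \<Omega> [v] f) (partials [v] (\<phi> n)))
        \<longlonglongrightarrow> - L2_inner \<Omega> (weak_partials \<Omega> [v] f) (weak_partials \<Omega> [v] g)"
      by (rule tendsto_minus, rule tendsto_L2_inner[where S = UNIV, OF _ _ _ _ _ _ 2[OF v]])
        (auto intro: wf wg test_L2 test_fun_partials \<phi> simp: L2_nrm_def)
    ultimately show ?thesis by (simp add: LIMSEQ_unique)
  qed
  then show ?thesis
    unfolding lap_def
    by (subst L2_inner_sum_left)
      (auto intro: weak_partials_L2[OF f] H_L2[OF gH] simp: indices_def sum_negf)
qed

text \<open>Both sides are minus the Dirichlet form, which is symmetric.\<close>

lemma lap_symmetric:
  assumes "f \<in> H 2 \<Omega>" "f \<in> H10 \<Omega>" "g \<in> H 2 \<Omega>" "g \<in> H10 \<Omega>"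
  shows "L2_inner \<Omega> (lap \<Omega> f) g = L2_inner \<Omega> f (lap \<Omega> g)"
  unfolding L2_inner_commute[of \<Omega> f] weak_Green[OF assms(1,4)] weak_Green[OF assms(3,2)]
  by (simp add: L2_inner_commute)

lemma lap_H2:
  assumes w: "w \<in> H 4 \<Omega>"
  shows "lap \<Omega> w \<in> H 2 \<Omega>"
  unfolding lap_def
proof (rule H_sum)
  fix v :: 'a assume v: "v \<in> Basis"
  then have vi: "[v, v] \<in> indices 4" by (simp add: indices_def)
  have "\<exists>g\<in>L2 \<Omega>. has_weak_partials \<Omega> vs (weak_partials \<Omega> [v, v] w) g" if "vs \<in> indices 2" for vs
  proof -
    \<comment> \<open>With \<open>[v, v]\<close> in front, the remaining
      \<open>partials vs \<phi>\<close> is itself a test function for the weak derivative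
      \<open>[v, v]\<close>. Two extra entries leave the sign unchanged.\<close>
    have vvs: "[v, v] @ vs \<in> indices 4" using v that by (auto simp: indices_def)
    have "has_weak_partials \<Omega> vs (weak_partials \<Omega> [v, v] w) (weak_partials \<Omega> ([v, v] @ vs) w)"
      unfolding has_weak_partials_iff
    proof
      fix \<phi> assume \<phi>: "\<phi> \<in> test_fun \<Omega>"
      show "L2_inner \<Omega> (weak_partials \<Omega> [v, v] w) (partials vs \<phi>)
          = (-1) ^ length vs * L2_inner \<Omega> (weak_partials \<Omega> ([v, v] @ vs) w) \<phi>"
        using L2_inner_weak_partials[OF w vi test_fun_partials[OF \<phi>], of vs]
          L2_inner_weak_partials[OF w vvs \<phi>] by (simp only: partials_append) simp
    qed
    then show ?thesis using weak_partials_L2[OF w vvs] by blast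
  qed
  then show "weak_partials \<Omega> [v, v] w \<in> H 2 \<Omega>"
    using weak_partials_L2[OF w vi] by (simp add: H_def)
qed

text \<open>Weak derivatives see only the class of \<open>f\<close>, so the zero function is one of
  them. Used to pass from \<open>u 0 = 0\<close> to a null initial value of
  \<open>L u\<close>.\<close>

lemma lap_cong_0:
  assumes f: "f \<in> H 2 \<Omega>" and 0: "AE x in lebesgue_on \<Omega>. f x = 0"
  shows "AE x in lebesgue_on \<Omega>. lap \<Omega> f x = 0"
proof -
  have "AE x in lebesgue_on \<Omega>. weak_partials \<Omega> [v, v] f x = 0" if "v \<in> Basis" for v
  proof (rule weak_partials_AE_eq[OF f _ L2_zero])
    show "has_weak_partials \<Omega> [v, v] f (\<lambda>x. 0)"
      using L2_inner_cong_AE[OF H_L2[OF f] L2_zero test_L2[OF test_fun_partials] 0]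
      by (simp add: has_weak_partials_iff L2_inner_zero)
  qed (use that in \<open>simp add: indices_def\<close>)
  then have "AE x in lebesgue_on \<Omega>. \<forall>v\<in>Basis. weak_partials \<Omega> [v, v] f x = 0"
    by (intro AE_finite_allI) auto
  then show ?thesis by eventually_elim (simp add: lap_def)
qed

text \<open>Boundedness of the Laplacian from H^2 to L^2; the factor counts the pure second
  derivatives, each bounded by the full norm. It is stated for a whole quotient because
  \<open>lap\<close> is additive only almost everywhere; \<open>r = 0\<close> is harmless since
  division by 0 gives 0.\<close>

lemma lap_diff_quotient:
  assumes f: "f \<in> H 2 \<Omega>" "g \<in> H 2 \<Omega>" "h \<in> H 2 \<Omega>"
  shows "L2_nrm \<Omega> (\<lambda>x. (lap \<Omega> f x - lap \<Omega> g x) / r - lap \<Omega> h x)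
    \<le> real DIM('a) * H_nrm 2 \<Omega> (\<lambda>x. (f x - g x) / r - h x)"
proof -
  let ?q = "\<lambda>x. inverse r * (f x - g x) - h x"
  have q: "?q \<in> H 2 \<Omega>" by (intro H_diff H_cmult f)
  have vi: "[v, v] \<in> indices 2" if "v \<in> Basis" for v :: 'a using that by (simp add: indices_def)
  have "AE x in lebesgue_on \<Omega>. weak_partials \<Omega> [v, v] ?q x =
      inverse r * (weak_partials \<Omega> [v, v] f x - weak_partials \<Omega> [v, v] g x) - weak_partials \<Omega> [v, v] h x"
    if v: "v \<in> Basis" for v
    using weak_partials_diff[OF H_cmult[OF H_diff[OF f(1,2)], of "inverse r"] f(3) vi[OF v]]
      weak_partials_cmult[OF H_diff[OF f(1,2)] vi[OF v], of "inverse r"]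
      weak_partials_diff[OF f(1,2) vi[OF v]]
    by eventually_elim simp
  then have "AE x in lebesgue_on \<Omega>. \<forall>v\<in>Basis. weak_partials \<Omega> [v, v] ?q x =
      inverse r * (weak_partials \<Omega> [v, v] f x - weak_partials \<Omega> [v, v] g x) - weak_partials \<Omega> [v, v] h x"
    by (intro AE_finite_allI) auto
  then have "AE x in lebesgue_on \<Omega>. (lap \<Omega> f x - lap \<Omega> g x) / r - lap \<Omega> h x = (\<Sum>v\<in>Basis. weak_partials \<Omega> [v, v] ?q x)"
    by eventually_elim
      (simp add: lap_def sum_subtractf divide_inverse mult.commute[of _ "inverse r"]
        sum_distrib_left[symmetric] right_diff_distrib)
  moreover have "(\<lambda>x. (lap \<Omega> f x - lap \<Omega> g x) / r - lap \<Omega> h x) \<in> L2 \<Omega>"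
    unfolding divide_inverse mult.commute[of _ "inverse r"]
    by (intro L2_diff L2_cmult lap_L2 f)
  moreover have qL: "weak_partials \<Omega> [v, v] ?q \<in> L2 \<Omega>" if "v \<in> Basis" for v
    by (rule weak_partials_L2[OF q vi[OF that]])
  ultimately have "L2_nrm \<Omega> (\<lambda>x. (lap \<Omega> f x - lap \<Omega> g x) / r - lap \<Omega> h x)
      = L2_nrm \<Omega> (\<lambda>x. \<Sum>v\<in>Basis. weak_partials \<Omega> [v, v] ?q x)"
    by (intro L2_nrm_cong_AE L2_sum)
  also have "\<dots> \<le> (\<Sum>v\<in>Basis. L2_nrm \<Omega> (weak_partials \<Omega> [v, v] ?q))"
    by (rule L2_nrm_sum[OF qL])
  also have "\<dots> \<le> (\<Sum>v\<in>(Basis::'a set). H_nrm 2 \<Omega> ?q)"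
    by (intro sum_mono L2_nrm_weak_partials_le_H_nrm vi)
  finally show ?thesis by (simp add: divide_inverse mult.commute)
qed

end

section \<open>Time derivatives in \<open>L\<^sup>2\<close>\<close>

text \<open>Norm differentiability relative to a set \<open>S\<close>, so that one notion covers the
  one-sided derivative at time 0 and reflected paths on a bounded interval.\<close>

definition has_L2_derivative ::
  "'a::euclidean_space set \<Rightarrow> (real \<Rightarrow> 'a \<Rightarrow> real) \<Rightarrow> ('a \<Rightarrow> real) \<Rightarrow> real \<Rightarrow> real set \<Rightarrow> bool" where
  "has_L2_derivative \<Omega> f f' t S \<longleftrightarrow>
     ((\<lambda>s. L2_nrm \<Omega> (\<lambda>x. (f s x - f t x) / (s - t) - f' x)) \<longlongrightarrow> 0) (at t within S)"

lemma has_L2_derivative_continuous: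
  assumes f: "\<And>s. s \<in> S \<Longrightarrow> f s \<in> L2 \<Omega>" "f' \<in> L2 \<Omega>" "t \<in> S" and d: "has_L2_derivative \<Omega> f f' t S"
  shows "((\<lambda>s. L2_nrm \<Omega> (\<lambda>x. f s x - f t x)) \<longlongrightarrow> 0) (at t within S)"
proof (rule Lim_null_comparison)
  let ?q = "\<lambda>s x. (f s x - f t x) / (s - t) - f' x"
  have "((\<lambda>s. \<bar>s - t\<bar> * (L2_nrm \<Omega> (?q s) + L2_nrm \<Omega> f')) \<longlongrightarrow> \<bar>t - t\<bar> * (0 + L2_nrm \<Omega> f')) (at t within S)"
    using d unfolding has_L2_derivative_def by (intro tendsto_intros)
  then show "((\<lambda>s. \<bar>s - t\<bar> * (L2_nrm \<Omega> (?q s) + L2_nrm \<Omega> f')) \<longlongrightarrow> 0) (at t within S)"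
    by simp
  have "L2_nrm \<Omega> (\<lambda>x. f s x - f t x) \<le> \<bar>s - t\<bar> * (L2_nrm \<Omega> (?q s) + L2_nrm \<Omega> f')" if "s \<in> S" "s \<noteq> t" for s
  proof -
    have "?q s \<in> L2 \<Omega>"
      unfolding divide_inverse mult.commute[of _ "inverse (s - t)"]
      by (intro L2_diff L2_cmult f that)
    have "L2_nrm \<Omega> (\<lambda>x. f s x - f t x) = L2_nrm \<Omega> (\<lambda>x. (s - t) * (?q s x + f' x))"
      using that by simp
    also have "\<dots> = \<bar>s - t\<bar> * L2_nrm \<Omega> (\<lambda>x. ?q s x + f' x)"
      by (rule L2_nrm_cmult)
    also have "\<dots> \<le> \<bar>s - t\<bar> * (L2_nrm \<Omega> (?q s) + L2_nrm \<Omega> f')"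
      by (intro mult_left_mono L2_nrm_triangle f \<open>?q s \<in> L2 \<Omega>\<close>) simp
    finally show ?thesis .
  qed
  then show "\<forall>\<^sub>F s in at t within S. norm (L2_nrm \<Omega> (\<lambda>x. f s x - f t x))
      \<le> \<bar>s - t\<bar> * (L2_nrm \<Omega> (?q s) + L2_nrm \<Omega> f')"
    by (simp add: eventually_at_filter)
qed

text \<open>The quotient splits into the quotient of \<open>f\<close> against the moving
  \<open>g s\<close> and the fixed \<open>f t\<close> against the quotient of \<open>g\<close>; the
  first part uses that \<open>g\<close> is continuous in L^2.\<close>

lemma has_real_derivative_L2_inner:
  assumes f: "\<And>s. s \<in> S \<Longrightarrow> f s \<in> L2 \<Omega>" "f' \<in> L2 \<Omega>" "has_L2_derivative \<Omega> f f' t S"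
    and g: "\<And>s. s \<in> S \<Longrightarrow> g s \<in> L2 \<Omega>" "g' \<in> L2 \<Omega>" "has_L2_derivative \<Omega> g g' t S"
    and t: "t \<in> S"
  shows "((\<lambda>s. L2_inner \<Omega> (f s) (g s)) has_real_derivative
    L2_inner \<Omega> f' (g t) + L2_inner \<Omega> (f t) g') (at t within S)"
proof -
  let ?F = "\<lambda>s x. (f s x - f t x) / (s - t)" and ?G = "\<lambda>s x. (g s x - g t x) / (s - t)"
  have q: "?F s \<in> L2 \<Omega>" "?G s \<in> L2 \<Omega>" if "s \<in> S" for s
    unfolding divide_inverse mult.commute[of _ "inverse (s - t)"]
    by (intro L2_diff L2_cmult f g that t)+
  have ev: "eventually (\<lambda>s. s \<in> S) (at t within S)"
    by (simp add: eventually_at_filter)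
  have "((\<lambda>s. L2_inner \<Omega> (?F s) (g s)) \<longlongrightarrow> L2_inner \<Omega> f' (g t)) (at t within S)"
    by (rule tendsto_L2_inner[where S = S])
      (use f(3) has_L2_derivative_continuous[OF g(1,2) t g(3)] in
        \<open>auto intro: f g t q ev simp: has_L2_derivative_def\<close>)
  moreover have "((\<lambda>s. L2_inner \<Omega> (f t) (?G s)) \<longlongrightarrow> L2_inner \<Omega> (f t) g') (at t within S)"
    by (rule tendsto_L2_inner[where S = S])
      (use g(3) in \<open>auto intro: f g t q ev simp: has_L2_derivative_def L2_nrm_def\<close>)
  ultimately have "((\<lambda>s. L2_inner \<Omega> (?F s) (g s) + L2_inner \<Omega> (f t) (?G s)) \<longlongrightarrow>
      L2_inner \<Omega> f' (g t) + L2_inner \<Omega> (f t) g') (at t within S)"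
    by (rule tendsto_add)
  moreover have eq: "L2_inner \<Omega> (?F s) (g s) + L2_inner \<Omega> (f t) (?G s)
      = (L2_inner \<Omega> (f s) (g s) - L2_inner \<Omega> (f t) (g t)) / (s - t)" if s: "s \<in> S" for s
  proof -
    have "L2_inner \<Omega> (?F s) (g s) = inverse (s - t) * (L2_inner \<Omega> (f s) (g s) - L2_inner \<Omega> (f t) (g s))"
      unfolding divide_inverse mult.commute[of _ "inverse (s - t)"] L2_inner_cmult_left
      by (subst L2_inner_diff_left) (auto intro: f g s t)
    moreover have "L2_inner \<Omega> (f t) (?G s) = inverse (s - t) * (L2_inner \<Omega> (f t) (g s) - L2_inner \<Omega> (f t) (g t))"
      unfolding divide_inverse mult.commute[of _ "inverse (s - t)"] L2_inner_cmult_right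
      by (subst L2_inner_diff_right) (auto intro: f g s t)
    ultimately show ?thesis by (simp add: divide_inverse algebra_simps)
  qed
  ultimately show ?thesis
    unfolding has_field_derivative_iff
    by (elim Lim_transform_eventually) (simp add: eventually_at_filter eq)
qed

text \<open>Applied with \<open>k = 1\<close> and \<open>k = -1\<close>, to read a solution at times
  t + s and t - s.\<close>

lemma has_L2_derivative_affine:
  assumes d: "has_L2_derivative \<Omega> f f' (k * t + c) S" and k: "k \<noteq> 0"
    and T: "\<And>s. s \<in> T \<Longrightarrow> k * s + c \<in> S"
  shows "has_L2_derivative \<Omega> (\<lambda>s. f (k * s + c)) (\<lambda>x. k * f' x) t T"
proof -
  let ?q = "\<lambda>s x. (f s x - f (k * t + c) x) / (s - (k * t + c)) - f' x"
  have "filterlim (\<lambda>s. k * s + c) (at (k * t + c) within S) (at t within T)"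
    unfolding filterlim_at
    using T k by (auto intro!: tendsto_intros simp: eventually_at_filter)
  from filterlim_compose[OF d[unfolded has_L2_derivative_def] this]
  have "((\<lambda>s. \<bar>k\<bar> * L2_nrm \<Omega> (?q (k * s + c))) \<longlongrightarrow> \<bar>k\<bar> * 0) (at t within T)"
    by (intro tendsto_mult tendsto_const)
  moreover have "\<bar>k\<bar> * L2_nrm \<Omega> (?q (k * s + c))
      = L2_nrm \<Omega> (\<lambda>x. (f (k * s + c) x - f (k * t + c) x) / (s - t) - k * f' x)" for s
  proof -
    have "k * s + c - (k * t + c) = k * (s - t)" by (simp add: algebra_simps)
    moreover have "k * (y / (k * e) - z) = y / e - k * z" for y e z
      using k by (cases "e = 0") (simp_all add: field_simps)
    ultimately have "k * ?q (k * s + c) x = (f (k * s + c) x - f (k * t + c) x) / (s - t) - k * f' x" for x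
      by simp
    then show ?thesis
      using L2_nrm_cmult[of \<Omega> k "?q (k * s + c)"] by simp
  qed
  ultimately show ?thesis by (simp add: has_L2_derivative_def)
qed

text \<open>Differentiability in the H^2 norm lets the Laplacian commute with the time derivative;
  this is what makes |L u|^2 differentiable in time.\<close>

lemma (in bounded_open) has_L2_derivative_lap:
  assumes f: "\<And>s. s \<ge> 0 \<Longrightarrow> f s \<in> H 2 \<Omega>" "f' \<in> H 2 \<Omega>" "t \<ge> 0"
    and d: "((\<lambda>s. H_nrm 2 \<Omega> (\<lambda>x. (f s x - f t x) / (s - t) - f' x)) \<longlongrightarrow> 0) (at t within {0..})"
  shows "has_L2_derivative \<Omega> (\<lambda>s. lap \<Omega> (f s)) (lap \<Omega> f') t {0..}"
  unfolding has_L2_derivative_def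
proof (rule Lim_null_comparison)
  show "((\<lambda>s. real DIM('a) * H_nrm 2 \<Omega> (\<lambda>x. (f s x - f t x) / (s - t) - f' x)) \<longlongrightarrow> 0) (at t within {0..})"
    using tendsto_mult[OF tendsto_const d] by simp
  show "\<forall>\<^sub>F s in at t within {0..}. norm (L2_nrm \<Omega> (\<lambda>x. (lap \<Omega> (f s) x - lap \<Omega> (f t) x) / (s - t) - lap \<Omega> f' x))
      \<le> real DIM('a) * H_nrm 2 \<Omega> (\<lambda>x. (f s x - f t x) / (s - t) - f' x)"
    using lap_diff_quotient[OF f(1) f(1)[OF f(3)] f(2)] by (simp add: eventually_at_filter)
qed

text \<open>The product with the integrating factor exp(-C t) is nonincreasing. The one-sided
  derivative at 0 enters only as continuity there.\<close>

lemma Gronwall_zero: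
  fixes G G' :: "real \<Rightarrow> real"
  assumes d: "\<And>t. t \<ge> 0 \<Longrightarrow> (G has_real_derivative G' t) (at t within {0..})"
    and le: "\<And>t. t \<ge> 0 \<Longrightarrow> G' t \<le> C * G t" and G0: "G 0 = 0" and t: "t \<ge> 0"
  shows "G t \<le> 0"
proof -
  have d': "((\<lambda>t. exp (- C * t) * G t) has_real_derivative exp (- C * s) * (G' s - C * G s)) (at s within {0..})"
    if "s \<ge> 0" for s
    using d[OF that] by (auto intro!: derivative_eq_intros simp: algebra_simps)
  have "exp (- C * t) * G t \<le> exp (- C * 0) * G 0"
  proof (rule DERIV_nonpos_imp_decreasing_open[OF t])
    have "continuous_on {0..} (\<lambda>t. exp (- C * t) * G t)"
      unfolding continuous_on_eq_continuous_within using d' DERIV_continuous by fastforce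
    then show "continuous_on {0..t} (\<lambda>t. exp (- C * t) * G t)"
      by (rule continuous_on_subset) auto
    fix s assume s: "0 < s" "s < t"
    have "at s within {0..} = at s" using s by (intro at_within_interior) auto
    moreover have "exp (- C * s) * (G' s - C * G s) \<le> 0"
      using le[of s] s by (intro mult_nonneg_nonpos) auto
    ultimately show "\<exists>y. ((\<lambda>t. exp (- C * t) * G t) has_real_derivative y) (at s) \<and> y \<le> 0"
      using d'[of s] s by auto
  qed
  then show ?thesis using G0 by (simp add: mult_le_0_iff)
qed

section \<open>The backward plate system\<close>

lemma C0_timeD: "C0_time X N f \<Longrightarrow> t \<ge> 0 \<Longrightarrow> f t \<in> X"
  by (simp add: C0_time_def)

lemma C1_timeD:
  assumes "C1_time X N f f'" "t \<ge> 0"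
  shows "f t \<in> X" "f' t \<in> X"
    and "((\<lambda>s. N (\<lambda>x. (f s x - f t x) / (s - t) - f' t x)) \<longlongrightarrow> 0) (at t within {0..})"
  using assms by (simp_all add: C1_time_def C0_time_def)

locale backward_plate = bounded_open \<Omega>
  for \<Omega> :: "'a::euclidean_space set" +
  fixes \<rho> a b c d \<eta> :: real and u ut utt \<theta> \<theta>t :: "real \<Rightarrow> 'a \<Rightarrow> real"
  assumes pos: "\<rho> > 0" "a > 0" "b > 0" "c > 0" "d > 0"
    and regular: "strong_regularity \<Omega> u ut utt \<theta> \<theta>t"
    and eq_u: "\<And>t. t \<ge> 0 \<Longrightarrow> AE x in lebesgue_on \<Omega>.
      \<rho> * utt t x = - c * lap \<Omega> (lap \<Omega> (u t)) x + \<eta> * lap \<Omega> (\<theta> t) x"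
    and eq_\<theta>: "\<And>t. t \<ge> 0 \<Longrightarrow> AE x in lebesgue_on \<Omega>.
      a * \<theta>t t x = d * lap \<Omega> (lap \<Omega> (\<theta> t)) x - b * lap \<Omega> (\<theta> t) x - \<eta> * lap \<Omega> (ut t) x"
    and init: "AE x in lebesgue_on \<Omega>. u 0 x = 0" "AE x in lebesgue_on \<Omega>. ut 0 x = 0"
      "AE x in lebesgue_on \<Omega>. \<theta> 0 x = 0"
begin

abbreviation inner_L2 :: "('a \<Rightarrow> real) \<Rightarrow> ('a \<Rightarrow> real) \<Rightarrow> real"  (infixl "\<odot>" 70)
  where "f \<odot> g \<equiv> L2_inner \<Omega> f g"

abbreviation "L \<equiv> lap \<Omega>"

abbreviation "dom_L \<equiv> H 2 \<Omega> \<inter> H10 \<Omega>"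

lemma dom_L_L2: "f \<in> dom_L \<Longrightarrow> f \<in> L2 \<Omega>" "f \<in> dom_L \<Longrightarrow> L f \<in> L2 \<Omega>"
  by (auto intro: H_L2 lap_L2)

lemma L_symmetric: "f \<in> dom_L \<Longrightarrow> g \<in> dom_L \<Longrightarrow> L f \<odot> g = f \<odot> L g"
  by (simp add: lap_symmetric)

text \<open>The conditions w = L w = 0 on the boundary place both \<open>w\<close> and
  \<open>L w\<close> in the domain of symmetry, so L can also be moved off
  \<open>L (L w)\<close>.\<close>

lemma H4_star_dom_L: "f \<in> H4_star \<Omega> \<Longrightarrow> f \<in> dom_L" "f \<in> H4_star \<Omega> \<Longrightarrow> L f \<in> dom_L"
  by (auto simp: H4_star_def zero_on_boundary_def intro: lap_H2 H_mono[of _ 4])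

lemma time:
  "C1_time (L2 \<Omega>) (L2_nrm \<Omega>) u ut" "C1_time (L2 \<Omega>) (L2_nrm \<Omega>) ut utt"
  "C1_time (L2 \<Omega>) (L2_nrm \<Omega>) \<theta> \<theta>t" "C1_time dom_L (H_nrm 2 \<Omega>) u ut"
  "C0_time (H4_star \<Omega>) (H_nrm 4 \<Omega>) u" "C0_time (H4_star \<Omega>) (H_nrm 4 \<Omega>) \<theta>"
  using regular by (simp_all add: strong_regularity_def)

lemma domains:
  assumes "t \<ge> 0"
  shows "u t \<in> dom_L" "ut t \<in> dom_L" "\<theta> t \<in> dom_L" "L (u t) \<in> dom_L" "L (\<theta> t) \<in> dom_L"
    "utt t \<in> L2 \<Omega>" "\<theta>t t \<in> L2 \<Omega>"
  using H4_star_dom_L C1_timeD(1,2)[OF time(1) assms] C1_timeD(1,2)[OF time(2) assms]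
    C1_timeD(1,2)[OF time(3) assms] C1_timeD(1,2)[OF time(4) assms]
    C0_timeD[OF time(5) assms] C0_timeD[OF time(6) assms]
  by simp_all

text \<open>Positions cited below: 1-2 are \<open>utt\<close>, \<open>\<theta>t\<close>; 3-7 are
  \<open>u\<close>, \<open>ut\<close>, \<open>\<theta>\<close>, \<open>L u\<close>,
  \<open>L \<theta>\<close>; 8-12 are L applied to 3-7.\<close>

lemmas domains_L2 = domains(6,7) domains(1-5)[THEN dom_L_L2(1)] domains(1-5)[THEN dom_L_L2(2)]

lemma derivatives:
  assumes "t \<ge> 0"
  shows "has_L2_derivative \<Omega> u (ut t) t {0..}"
    and "has_L2_derivative \<Omega> ut (utt t) t {0..}"
    and "has_L2_derivative \<Omega> \<theta> (\<theta>t t) t {0..}"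
    and "has_L2_derivative \<Omega> (\<lambda>t. L (u t)) (L (ut t)) t {0..}"
proof -
  show "has_L2_derivative \<Omega> u (ut t) t {0..}" "has_L2_derivative \<Omega> ut (utt t) t {0..}"
    "has_L2_derivative \<Omega> \<theta> (\<theta>t t) t {0..}"
    using C1_timeD(3)[OF time(1) assms] C1_timeD(3)[OF time(2) assms] C1_timeD(3)[OF time(3) assms]
    by (simp_all add: has_L2_derivative_def)
  show "has_L2_derivative \<Omega> (\<lambda>t. L (u t)) (L (ut t)) t {0..}"
  proof (rule has_L2_derivative_lap[OF _ _ assms])
    show "((\<lambda>s. H_nrm 2 \<Omega> (\<lambda>x. (u s x - u t x) / (s - t) - ut t x)) \<longlongrightarrow> 0) (at t within {0..})"
      by (rule C1_timeD(3)[OF time(4) assms])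
  qed (use domains assms in auto)
qed

text \<open>The equation holds only almost everywhere, so it is used solely in this form, paired
  with some \<open>z\<close>.\<close>

lemma utt_inner:
  assumes t: "t \<ge> 0" and z: "z \<in> L2 \<Omega>"
  shows "\<rho> * (utt t \<odot> z) = - c * (L (L (u t)) \<odot> z) + \<eta> * (L (\<theta> t) \<odot> z)"
proof -
  note m = domains_L2[OF t]
  have "(\<lambda>x. \<rho> * utt t x) \<odot> z = (\<lambda>x. - c * L (L (u t)) x + \<eta> * L (\<theta> t) x) \<odot> z"
    by (rule L2_inner_cong_AE[OF _ _ z eq_u[OF t]]) (intro L2_add L2_cmult m)+
  then show ?thesis
    using m z by (simp only: L2_inner_add_left L2_inner_cmult_left L2_cmult)
qed

lemma \<theta>t_inner:
  assumes t: "t \<ge> 0" and z: "z \<in> L2 \<Omega>"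
  shows "a * (\<theta>t t \<odot> z) = d * (L (L (\<theta> t)) \<odot> z) - b * (L (\<theta> t) \<odot> z) - \<eta> * (L (ut t) \<odot> z)"
proof -
  note m = domains_L2[OF t]
  have "(\<lambda>x. a * \<theta>t t x) \<odot> z = (\<lambda>x. d * L (L (\<theta> t)) x - b * L (\<theta> t) x - \<eta> * L (ut t) x) \<odot> z"
    by (rule L2_inner_cong_AE[OF _ _ z eq_\<theta>[OF t]]) (intro L2_diff L2_cmult m)+
  then show ?thesis
    using m z by (simp only: L2_inner_diff_left L2_inner_cmult_left L2_cmult L2_diff)
qed

lemma initial_inner:
  assumes "z \<in> L2 \<Omega>"
  shows "u 0 \<odot> z = 0" "ut 0 \<odot> z = 0" "\<theta> 0 \<odot> z = 0" "L (u 0) \<odot> z = 0"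
proof -
  have "f \<odot> z = 0" if "f \<in> L2 \<Omega>" "AE x in lebesgue_on \<Omega>. f x = 0" for f
    using L2_inner_cong_AE[OF that(1) L2_zero assms that(2)] by (simp add: L2_inner_zero)
  moreover have "AE x in lebesgue_on \<Omega>. L (u 0) x = 0"
    using lap_cong_0[OF _ init(1)] domains(1)[of 0] by simp
  ultimately show "u 0 \<odot> z = 0" "ut 0 \<odot> z = 0" "\<theta> 0 \<odot> z = 0" "L (u 0) \<odot> z = 0"
    using init domains_L2[of 0] by auto
qed

text \<open>The operator of the first order system for \<open>(ut, L u, \<theta>)\<close> is symmetric for the indefinite
  form below, so pairing the states at times \<open>t + s\<close> and \<open>t - s\<close> gives a constant in \<open>s\<close>.\<close>

lemma Lagrange_identity:
  assumes t: "t \<ge> 0"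
  shows "\<rho> * (ut t \<odot> ut t) = c * (L (u t) \<odot> L (u t)) + a * (\<theta> t \<odot> \<theta> t)"
proof -
  define T where "T = {0..t}"
  \<comment> \<open>The redundant factor 1 matches the shape \<open>k * s + c\<close> of the affine
    chain rule. Both times are nonnegative for \<open>s\<close> in \<open>T\<close>.\<close>
  let ?p = "\<lambda>s. 1 * s + t" and ?m = "\<lambda>s. -1 * s + t"
  \<comment> \<open>The indefinite form with signs +, -, - on the components \<open>ut\<close>,
    \<open>L u\<close>, \<open>\<theta>\<close>.\<close>
  define g where "g s = \<rho> * (ut (?p s) \<odot> ut (?m s)) - c * (L (u (?p s)) \<odot> L (u (?m s)))
    - a * (\<theta> (?p s) \<odot> \<theta> (?m s))" for s
  have "(g has_real_derivative 0) (at s within T)" if s: "s \<in> T" for s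
  proof -
    have p: "0 \<le> ?p s" and m: "0 \<le> ?m s" using s by (auto simp: T_def)
    have pT: "?p r \<in> {0..}" and mT: "?m r \<in> {0..}" if "r \<in> T" for r
      using that by (auto simp: T_def)
    have D: "((\<lambda>s. f (?p s) \<odot> f (?m s)) has_real_derivative
        f' (?p s) \<odot> f (?m s) - f (?p s) \<odot> f' (?m s)) (at s within T)"
      if f: "\<And>r. r \<ge> 0 \<Longrightarrow> f r \<in> L2 \<Omega>" "\<And>r. r \<ge> 0 \<Longrightarrow> f' r \<in> L2 \<Omega>"
        and d: "\<And>r. r \<ge> 0 \<Longrightarrow> has_L2_derivative \<Omega> f (f' r) r {0..}" for f f'
    proof -
      have "((\<lambda>s. f (?p s) \<odot> f (?m s)) has_real_derivative
          (\<lambda>x. 1 * f' (?p s) x) \<odot> f (?m s) + f (?p s) \<odot> (\<lambda>x. -1 * f' (?m s) x)) (at s within T)"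
        by (rule has_real_derivative_L2_inner[OF _ _ has_L2_derivative_affine[OF d[OF p] _ pT]
              _ _ has_L2_derivative_affine[OF d[OF m] _ mT] s])
          (use pT mT p m f in \<open>auto intro!: L2_cmult L2_uminus\<close>)
      then show ?thesis by (simp only: L2_inner_cmult_left L2_inner_cmult_right) simp
    qed
    note mp = domains_L2[OF p] and mm = domains_L2[OF m]
    have "(g has_real_derivative
        \<rho> * (utt (?p s) \<odot> ut (?m s) - ut (?p s) \<odot> utt (?m s))
        - c * (L (ut (?p s)) \<odot> L (u (?m s)) - L (u (?p s)) \<odot> L (ut (?m s)))
        - a * (\<theta>t (?p s) \<odot> \<theta> (?m s) - \<theta> (?p s) \<odot> \<theta>t (?m s))) (at s within T)"
      unfolding g_def
      by (intro DERIV_diff DERIV_cmult D) (auto intro: domains_L2 derivatives)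
    moreover have "\<rho> * (utt (?p s) \<odot> ut (?m s) - ut (?p s) \<odot> utt (?m s))
        - c * (L (ut (?p s)) \<odot> L (u (?m s)) - L (u (?p s)) \<odot> L (ut (?m s)))
        - a * (\<theta>t (?p s) \<odot> \<theta> (?m s) - \<theta> (?p s) \<odot> \<theta>t (?m s)) = 0"
    \<comment> \<open>Moving L across the pairings cancels everything: the elastic terms against the
      derivative of the \<open>c\<close> part, the diffusion and \<open>b\<close> terms within the
      \<open>\<theta>\<close> part, and the coupling terms between the \<open>\<rho>\<close> and
      \<open>a\<close> parts.\<close>
    proof -
      note dp = domains[OF p] and dm = domains[OF m]
      have "\<rho> * (utt (?p s) \<odot> ut (?m s)) = - c * (L (u (?p s)) \<odot> L (ut (?m s))) + \<eta> * (\<theta> (?p s) \<odot> L (ut (?m s)))"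
        using utt_inner[OF p mm(4)] L_symmetric[OF dp(4) dm(2)] L_symmetric[OF dp(3) dm(2)] by simp
      moreover have "\<rho> * (ut (?p s) \<odot> utt (?m s)) = - c * (L (ut (?p s)) \<odot> L (u (?m s))) + \<eta> * (L (ut (?p s)) \<odot> \<theta> (?m s))"
        using utt_inner[OF m mp(4)] L_symmetric[OF dp(2) dm(4)] L_symmetric[OF dp(2) dm(3)]
        by (simp add: L2_inner_commute[of \<Omega> _ "ut (s + t)"])
      moreover have "a * (\<theta>t (?p s) \<odot> \<theta> (?m s)) = d * (L (\<theta> (?p s)) \<odot> L (\<theta> (?m s)))
          - b * (L (\<theta> (?p s)) \<odot> \<theta> (?m s)) - \<eta> * (L (ut (?p s)) \<odot> \<theta> (?m s))"
        using \<theta>t_inner[OF p mm(5)] L_symmetric[OF dp(5) dm(3)] by simp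
      moreover have "a * (\<theta> (?p s) \<odot> \<theta>t (?m s)) = d * (L (\<theta> (?p s)) \<odot> L (\<theta> (?m s)))
          - b * (L (\<theta> (?p s)) \<odot> \<theta> (?m s)) - \<eta> * (\<theta> (?p s) \<odot> L (ut (?m s)))"
        using \<theta>t_inner[OF m mp(5)] L_symmetric[OF dp(3) dm(5)] L_symmetric[OF dp(3) dm(3)]
        by (simp add: L2_inner_commute[of \<Omega> _ "\<theta> (s + t)"])
      ultimately show ?thesis by (simp only: right_diff_distrib)
    qed
    ultimately show ?thesis by simp
  qed
  then obtain k where k: "\<And>s. s \<in> T \<Longrightarrow> g s = k"
    using has_field_derivative_zero_constant[of T g] by (auto simp: T_def)
  \<comment> \<open>At s = 0 both states are those at time t; at s = t one of them is the null
    initial state.\<close>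
  have "g 0 = g t"
    using k t by (simp add: T_def)
  also have "g t = 0"
    using initial_inner domains_L2[of "t + t"] t by (simp add: g_def L2_inner_commute[of \<Omega> _ "ut 0"] L2_inner_commute[of \<Omega> _ "\<theta> 0"]
        L2_inner_commute[of \<Omega> _ "L (u 0)"])
  finally show ?thesis by (simp add: g_def)
qed

text \<open>This is \<open>E\<^sub>1 / 2 + E\<^sub>2\<close>; the negative sign of the last term is what makes the dissipation favourable.\<close>

definition energy :: "real \<Rightarrow> real" where
  "energy t = 3 / 4 * \<rho> * (ut t \<odot> ut t) + 3 / 4 * c * (L (u t) \<odot> L (u t)) - 1 / 4 * a * (\<theta> t \<odot> \<theta> t)"

text \<open>The Lagrange identity trades the negative \<open>\<theta>\<close> term for -1/4 of the
  kinetic and +1/4 of the elastic part.\<close>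

lemma energy_eq:
  assumes "t \<ge> 0"
  shows "energy t = \<rho> / 2 * (ut t \<odot> ut t) + c * (L (u t) \<odot> L (u t))"
  using Lagrange_identity[OF assms] unfolding energy_def by linarith

text \<open>The elastic terms cancel. The coupling contributes 3/2 from the equation for
  \<open>ut\<close> and 1/2 from the one for \<open>\<theta>\<close>, which add up because the
  \<open>\<theta>\<close> part has a negative weight.\<close>

lemma energy_derivative:
  assumes t: "t \<ge> 0"
  shows "(energy has_real_derivative
    - d / 2 * (L (\<theta> t) \<odot> L (\<theta> t)) + b / 2 * (L (\<theta> t) \<odot> \<theta> t) + 2 * \<eta> * (L (\<theta> t) \<odot> ut t)) (at t within {0..})"
proof -
  note m = domains_L2[OF t] and D = domains[OF t]
  have E: "((\<lambda>s. f s \<odot> f s) has_real_derivative 2 * (f' \<odot> f t)) (at t within {0..})"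
    if "\<And>r. r \<ge> 0 \<Longrightarrow> f r \<in> L2 \<Omega>" "f' \<in> L2 \<Omega>" "has_L2_derivative \<Omega> f f' t {0..}" for f f'
    using has_real_derivative_L2_inner[of "{0..}" f \<Omega> f' t f f'] that t
    by (simp add: L2_inner_commute[of \<Omega> "f t"])
  have "(energy has_real_derivative
      3 / 4 * \<rho> * (2 * (utt t \<odot> ut t)) + 3 / 4 * c * (2 * (L (ut t) \<odot> L (u t)))
      - 1 / 4 * a * (2 * (\<theta>t t \<odot> \<theta> t))) (at t within {0..})"
    unfolding energy_def[abs_def]
    by (intro DERIV_diff DERIV_add DERIV_cmult E) (auto intro: domains_L2 derivatives t)
  moreover have "\<rho> * (utt t \<odot> ut t) = - c * (L (ut t) \<odot> L (u t)) + \<eta> * (L (\<theta> t) \<odot> ut t)"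
    using utt_inner[OF t m(4)] L_symmetric[OF D(2,4)] by (simp add: L2_inner_commute)
  moreover have "a * (\<theta>t t \<odot> \<theta> t) = d * (L (\<theta> t) \<odot> L (\<theta> t)) - b * (L (\<theta> t) \<odot> \<theta> t) - \<eta> * (L (\<theta> t) \<odot> ut t)"
    using \<theta>t_inner[OF t m(5)] L_symmetric[OF D(5,3)] L_symmetric[OF D(2,3)] by (simp add: L2_inner_commute)
  ultimately show ?thesis
    by (elim DERIV_cong) (simp add: algebra_simps)
qed

text \<open>With X = |L \<theta>| and K = b/2 |\<theta>| + 2 |\<eta>| |ut|, the left side is at most
  X K - d X^2 / 2, hence at most K^2 / (2 d). The constant comes from bounding K^2 by (b^2/a + 16
  \<eta>^2/\<rho>) times the energy.\<close>

lemma energy_derivative_le: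
  assumes t: "t \<ge> 0"
  shows "- d / 2 * (L (\<theta> t) \<odot> L (\<theta> t)) + b / 2 * (L (\<theta> t) \<odot> \<theta> t) + 2 * \<eta> * (L (\<theta> t) \<odot> ut t)
    \<le> (b\<^sup>2 / (2 * a) + 8 * \<eta>\<^sup>2 / \<rho>) / d * energy t"
proof -
  note m = domains_L2[OF t]
  define X Y V where "X = L2_nrm \<Omega> (L (\<theta> t))" and "Y = L2_nrm \<Omega> (\<theta> t)" and "V = L2_nrm \<Omega> (ut t)"
  have "0 \<le> c * (L (u t) \<odot> L (u t))"
    using pos by (simp add: L2_inner_self)
  \<comment> \<open>The energy controls \<open>V\<close> directly; it controls \<open>Y\<close>
    because the Lagrange identity bounds a Y^2 by \<rho> V^2.\<close>
  then have "\<rho> * V\<^sup>2 \<le> 2 * energy t" "a * Y\<^sup>2 \<le> 2 * energy t"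
    using energy_eq[OF t] Lagrange_identity[OF t] unfolding V_def Y_def L2_inner_self[symmetric]
    by - linarith+
  then have "V\<^sup>2 \<le> 2 * energy t / \<rho>" "Y\<^sup>2 \<le> 2 * energy t / a"
    using pos by (simp_all add: pos_le_divide_eq mult.commute)
  then have "b\<^sup>2 / 4 * Y\<^sup>2 \<le> b\<^sup>2 / 4 * (2 * energy t / a)"
    "4 * \<eta>\<^sup>2 * V\<^sup>2 \<le> 4 * \<eta>\<^sup>2 * (2 * energy t / \<rho>)"
    by (intro mult_left_mono; simp)+
  then have *: "(b / 2 * Y)\<^sup>2 \<le> b\<^sup>2 / 4 * (2 * energy t / a)"
    "(2 * \<bar>\<eta>\<bar> * V)\<^sup>2 \<le> 4 * \<eta>\<^sup>2 * (2 * energy t / \<rho>)"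
    by (simp_all add: power_mult_distrib power_divide)
  have "(b / 2 * Y + 2 * \<bar>\<eta>\<bar> * V)\<^sup>2 \<le> 2 * (b / 2 * Y)\<^sup>2 + 2 * (2 * \<bar>\<eta>\<bar> * V)\<^sup>2"
    using sum_squares_bound[of "b / 2 * Y" "2 * \<bar>\<eta>\<bar> * V"] unfolding power2_sum by linarith
  also have "\<dots> \<le> 2 * (b\<^sup>2 / 4 * (2 * energy t / a)) + 2 * (4 * \<eta>\<^sup>2 * (2 * energy t / \<rho>))"
    using * by linarith
  also have "\<dots> = (b\<^sup>2 / a + 16 * \<eta>\<^sup>2 / \<rho>) * energy t"
    using pos by (simp add: field_simps)
  finally have sq: "(b / 2 * Y + 2 * \<bar>\<eta>\<bar> * V)\<^sup>2 \<le> (b\<^sup>2 / a + 16 * \<eta>\<^sup>2 / \<rho>) * energy t" .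
  have "L (\<theta> t) \<odot> \<theta> t \<le> X * Y"
    using L2_Cauchy_Schwarz[of "L (\<theta> t)" \<Omega> "\<theta> t"] m by (simp add: X_def Y_def)
  moreover have "\<eta> * (L (\<theta> t) \<odot> ut t) \<le> \<bar>\<eta>\<bar> * (X * V)"
  proof -
    have "\<bar>\<eta>\<bar> * \<bar>L (\<theta> t) \<odot> ut t\<bar> \<le> \<bar>\<eta>\<bar> * (X * V)"
      using L2_Cauchy_Schwarz[of "L (\<theta> t)" \<Omega> "ut t"] m
      by (intro mult_left_mono) (simp_all add: X_def V_def)
    then show ?thesis
      using abs_ge_self[of "\<eta> * (L (\<theta> t) \<odot> ut t)"] by (simp add: abs_mult)
  qed
  ultimately have "- d / 2 * (L (\<theta> t) \<odot> L (\<theta> t)) + b / 2 * (L (\<theta> t) \<odot> \<theta> t) + 2 * \<eta> * (L (\<theta> t) \<odot> ut t)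
      \<le> - d / 2 * X\<^sup>2 + b / 2 * (X * Y) + 2 * (\<bar>\<eta>\<bar> * (X * V))"
    using mult_left_mono[of "L (\<theta> t) \<odot> \<theta> t" "X * Y" "b / 2"] pos
    unfolding X_def L2_inner_self[symmetric] by linarith
  \<comment> \<open>Completing the square in \<open>X\<close>.\<close>
  also have "\<dots> = (b / 2 * Y + 2 * \<bar>\<eta>\<bar> * V)\<^sup>2 / (2 * d) - (d * X - (b / 2 * Y + 2 * \<bar>\<eta>\<bar> * V))\<^sup>2 / (2 * d)"
    using pos by (simp add: field_simps power2_eq_square)
  also have "\<dots> \<le> (b\<^sup>2 / a + 16 * \<eta>\<^sup>2 / \<rho>) * energy t / (2 * d)"
  proof -
    have "(b / 2 * Y + 2 * \<bar>\<eta>\<bar> * V)\<^sup>2 / (2 * d) \<le> (b\<^sup>2 / a + 16 * \<eta>\<^sup>2 / \<rho>) * energy t / (2 * d)"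
      using pos by (intro divide_right_mono sq) simp
    moreover have "0 \<le> (d * X - (b / 2 * Y + 2 * \<bar>\<eta>\<bar> * V))\<^sup>2 / (2 * d)"
      using pos by simp
    ultimately show ?thesis by linarith
  qed
  also have "\<dots> = (b\<^sup>2 / (2 * a) + 8 * \<eta>\<^sup>2 / \<rho>) / d * energy t"
    using pos by (simp add: field_simps)
  finally show ?thesis .
qed

lemma AE_zero_iff: "f \<in> L2 \<Omega> \<Longrightarrow> f \<odot> f = 0 \<longleftrightarrow> (AE x in lebesgue_on \<Omega>. f x = 0)"
  by (simp add: L2_inner_self L2_nrm_eq_0_iff)

lemma ut_\<theta>_zero:
  assumes t: "t \<ge> 0"
  shows "ut t \<odot> ut t = 0" "\<theta> t \<odot> \<theta> t = 0"
proof -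
  have E0: "energy 0 = 0"
    using initial_inner domains_L2[of 0] by (simp add: energy_def)
  have "energy t \<le> 0"
    by (rule Gronwall_zero[OF energy_derivative energy_derivative_le E0 t])
  then have 1: "\<rho> / 2 * (ut t \<odot> ut t) + c * (L (u t) \<odot> L (u t)) \<le> 0"
    using energy_eq[OF t] by simp
  have nonneg: "f \<odot> f \<ge> 0" for f by (simp add: L2_inner_self)
  have "0 \<le> \<rho> / 2 * (ut t \<odot> ut t)" "0 \<le> c * (L (u t) \<odot> L (u t))"
    using pos nonneg by simp_all
  with 1 have "\<rho> / 2 * (ut t \<odot> ut t) = 0" "c * (L (u t) \<odot> L (u t)) = 0" by linarith+
  with pos show "ut t \<odot> ut t = 0" by simp
  \<comment> \<open>The positive form of the energy no longer contains \<open>\<theta>\<close>; the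
    Lagrange identity recovers it from \<open>ut\<close> and \<open>L u\<close>.\<close>
  with \<open>c * _ = 0\<close> Lagrange_identity[OF t] pos show "\<theta> t \<odot> \<theta> t = 0" by simp
qed

text \<open>Obtained by integrating \<open>ut = 0\<close> from the null initial value, as Gronwall
  with constant 0, rather than from \<open>L u = 0\<close>, which would call for injectivity of
  L.\<close>

lemma u_zero:
  assumes t: "t \<ge> 0"
  shows "u t \<odot> u t = 0"
proof -
  have "((\<lambda>s. u s \<odot> u s) has_real_derivative 0) (at s within {0..})" if s: "s \<ge> 0" for s
  proof -
    note m = domains_L2[OF s]
    have "((\<lambda>s. u s \<odot> u s) has_real_derivative ut s \<odot> u s + u s \<odot> ut s) (at s within {0..})"
      by (rule has_real_derivative_L2_inner) (use s in \<open>auto intro: domains_L2 derivatives\<close>)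
    moreover have "L2_nrm \<Omega> (ut s) = 0"
      using ut_\<theta>_zero(1)[OF s] by (simp add: L2_inner_self)
    then have "ut s \<odot> u s = 0"
      using L2_Cauchy_Schwarz[of "ut s" \<Omega> "u s"] m by simp
    ultimately show ?thesis by (simp add: L2_inner_commute)
  qed
  then have "u t \<odot> u t \<le> 0"
    using Gronwall_zero[of "\<lambda>s. u s \<odot> u s" "\<lambda>s. 0" 0 t] t initial_inner(1) domains_L2(3)[of 0] by simp
  then show ?thesis by (simp add: L2_inner_self)
qed

end

theorem theorem5p1:
  fixes \<Omega> :: "'a::euclidean_space set"
    and \<rho> a b c d \<eta> :: real
    and u ut utt \<theta> \<theta>t :: "real \<Rightarrow> 'a \<Rightarrow> real"
  assumes "bounded_smooth_domain \<Omega>"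
    and "\<rho> > 0" "a > 0" "b > 0" "c > 0" "d > 0" "\<eta> \<noteq> 0"
    and "strong_regularity \<Omega> u ut utt \<theta> \<theta>t"
    and "\<And>t. t \<ge> 0 \<Longrightarrow> AE x in lebesgue_on \<Omega>.
           \<rho> * utt t x = - c * lap \<Omega> (lap \<Omega> (u t)) x + \<eta> * lap \<Omega> (\<theta> t) x"
    and "\<And>t. t \<ge> 0 \<Longrightarrow> AE x in lebesgue_on \<Omega>.
           a * \<theta>t t x = d * lap \<Omega> (lap \<Omega> (\<theta> t)) x - b * lap \<Omega> (\<theta> t) x - \<eta> * lap \<Omega> (ut t) x"
    and "\<And>t. t > 0 \<Longrightarrow> zero_on_boundary \<Omega> (u t) \<and> zero_on_boundary \<Omega> (lap \<Omega> (u t)) \<and>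
           zero_on_boundary \<Omega> (\<theta> t) \<and> zero_on_boundary \<Omega> (lap \<Omega> (\<theta> t))"
    and "AE x in lebesgue_on \<Omega>. u 0 x = 0"
    and "AE x in lebesgue_on \<Omega>. ut 0 x = 0"
    and "AE x in lebesgue_on \<Omega>. \<theta> 0 x = 0"
  shows "\<forall>t\<ge>0. (AE x in lebesgue_on \<Omega>. u t x = 0) \<and> (AE x in lebesgue_on \<Omega>. \<theta> t x = 0)"
proof -
  interpret backward_plate \<Omega> \<rho> a b c d \<eta> u ut utt \<theta> \<theta>t
    by unfold_locales (use assms in \<open>auto simp: bounded_smooth_domain_def\<close>)
  show ?thesis
    using AE_zero_iff[OF domains_L2(3)] AE_zero_iff[OF domains_L2(5)] u_zero ut_\<theta>_zero(2) by simp
qed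

end
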